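(* Let $X_0$ be a compact complex manifold and let $\varphi=\varphi(t)=\sum_{i\ge1}\varphi_i t^i$ be a holomorphic family, in one complex parameter $t$ near $0$, of Beltrami differentials on $X_0$ satisfying the integrability condition $\bar\partial\varphi=\frac12[\varphi,\varphi]$. Let $N\ge 0$ and suppose the power series $\omega(t)=\sum_{k=0}^\infty\sum_{i+j=k}\omega_{i,j}t^i\bar t^j$ of $(1,1)$-forms on $X_0$ is a real formal solution, up to degree $N$, of the system $$\begin{cases}\bar\partial\omega=\bar\partial(\overline\varphi\varphi\lrcorner\omega-\varphi\lrcorner\overline\varphi\lrcorner\omega)-\partial(\varphi\lrcorner\omega),\\ \partial\omega=\partial(\varphi\overline\varphi\lrcorner\omega-\overline\varphi\lrcorner\varphi\lrcorner\omega)-\bar\partial(\overline\varphi\lrcorner\omega).\end{cases}$$ Then $\bar\partial\big(\varphi(t)\lrcorner\omega(t)\big)_k=0$ for each $0\le k\le N+1$, and $\omega(t)$ is also a real formal solution, up to degree $N$, of the system $$\begin{cases}([\partial,\iota_\varphi]+\bar\partial)\big((\mathbf 1-\overline\varphi\varphi)\lrcorner\omega\big)=0,\\ ([\bar\partial,\iota_{\overline\varphi}]+\partial)\big((\mathbf 1-\varphi\overline\varphi)\lrcorner\omega\big)=0.\end{cases}$$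
   Context: A Beltrami differential is an element $\varphi\in A^{0,1}(X_0,T^{1,0}_{X_0})$, locally $\varphi=\varphi^s_{\bar t}\,d\bar z^t\otimes\frac{\partial}{\partial z^s}$; the contraction $\iota_\varphi=\varphi\lrcorner$ is the degree-zero derivation with $\varphi\lrcorner dz^s=\varphi^s_{\bar t}d\bar z^t$, $\varphi\lrcorner d\bar z^s=0$, and $\iota_{\overline\varphi}=\overline\varphi\lrcorner$ is its conjugate. Successive contractions $\varphi\lrcorner\overline\varphi\lrcorner\omega$ mean $\varphi\lrcorner(\overline\varphi\lrcorner\omega)$. The products are $\overline\varphi\varphi:=\varphi\lrcorner\overline\varphi\in A^{0,1}(X_0,T^{0,1}_{X_0})$ (contract the form part of $\overline\varphi$ with $\varphi$), locally $\varphi^t_{\bar l}\,\overline{\varphi}^{\bar s}_{t}\,d\bar z^l\otimes\frac{\partial}{\partial\bar z^s}$, and $\varphi\overline\varphi:=\overline\varphi\lrcorner\varphi$ (its conjugate); they act on forms by contraction as degree-zero derivations. $\mathbf 1$ is the identity operator on forms. $[\partial,\iota_\varphi]=\partial\circ\iota_\varphi-\iota_\varphi\circ\partial$, and similarly for the conjugate. $[\cdot,\cdot]$ between Beltrami differentials is the usual bracket: for $\phi=\phi^i\partial_i,\psi=\psi^j\partial_j$, $[\phi,\psi]=\sum_{i,j}(\phi^i\wedge\partial_i\psi^j+\psi^i\wedge\partial_i\phi^j)\partial_j$. For a power series $\alpha(t)=\sum\alpha_{i,j}t^i\bar t^j$, $\alpha_k=(\alpha(t))_k=\sum_{i+j=k}\alpha_{i,j}t^i\bar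 t^j$ is its homogeneous part of degree $k$. "Formal solution up to degree $N$" means the homogeneous parts of degree $k$ of both sides agree for all $0\le k\le N$; "real" means $\overline{\omega(t)}=\omega(t)$ (as formal series, i.e. $\overline{\omega_{i,j}}=\omega_{j,i}$). *)

theory Defs
  imports "HOL-Analysis.Analysis" "HOL-Library.Function_Algebras"
begin

section \<open>Calculus on open subsets of complex coordinate space\<close>

fun Ck_on :: "nat \<Rightarrow> ('v::real_normed_vector \<Rightarrow> 'w::real_normed_vector) \<Rightarrow> 'v set \<Rightarrow> bool" where
  "Ck_on 0 f S \<longleftrightarrow> continuous_on S f"
| "Ck_on (Suc k) f S \<longleftrightarrow>
     (\<forall>x\<in>S. f differentiable (at x)) \<and> (\<forall>v. Ck_on k (\<lambda>x. frechet_derivative f (at x) v) S)"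

text \<open>Real smoothness; only meant for open \<open>S\<close>.\<close>

definition smooth_on :: "('v::real_normed_vector \<Rightarrow> 'w::real_normed_vector) \<Rightarrow> 'v set \<Rightarrow> bool" where
  "smooth_on f S \<longleftrightarrow> (\<forall>k. Ck_on k f S)"

text \<open>Holomorphy in several variables, for open \<open>S\<close>: the real derivative is complex linear.\<close>

definition holo_on :: "(complex^'n::finite \<Rightarrow> complex^'m::finite) \<Rightarrow> (complex^'n) set \<Rightarrow> bool" where
  "holo_on f S \<longleftrightarrow>
     (\<forall>x\<in>S. \<exists>D. (f has_derivative D) (at x) \<and> (\<forall>c v. D (c *s v) = c *s D v))"

text \<open>
  Indices in \<open>'n + 'n\<close> label the complexified coordinate frame: \<open>Inl s\<close> stands for
  \<open>z\<^sup>s\<close> (that is, for \<open>dz\<^sup>s\<close> or \<open>\<partial>/\<partial>z\<^sup>s\<close>) and \<open>Inr s\<close> for its complex conjugate.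
\<close>

definition bar :: "'n + 'n \<Rightarrow> 'n + 'n" where
  "bar i = (case i of Inl s \<Rightarrow> Inr s | Inr s \<Rightarrow> Inl s)"

definition coordinate :: "'n::finite + 'n \<Rightarrow> complex^'n \<Rightarrow> complex" where
  "coordinate i z = (case i of Inl s \<Rightarrow> z $ s | Inr s \<Rightarrow> cnj (z $ s))"

text \<open>Wirtinger derivatives.\<close>

definition wirtinger :: "'n::finite + 'n \<Rightarrow> (complex^'n \<Rightarrow> complex) \<Rightarrow> complex^'n \<Rightarrow> complex" where
  "wirtinger i f x = (let D = frechet_derivative f (at x) in
     case i of
       Inl s \<Rightarrow> (D (axis s 1) - \<i> * D (axis s \<i>)) / 2
     | Inr s \<Rightarrow> (D (axis s 1) + \<i> * D (axis s \<i>)) / 2)"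


section \<open>Complex manifolds\<close>

text \<open>A chart is a pair of its domain and its coordinate map (irrelevant off the domain).\<close>

type_synonym ('a, 'n) chart = "'a set \<times> ('a \<Rightarrow> complex^'n)"

definition chart_image :: "('a, 'n::finite) chart \<Rightarrow> (complex^'n) set" where
  "chart_image c = snd c ` fst c"

definition transition :: "('a, 'n::finite) chart \<Rightarrow> ('a, 'n) chart \<Rightarrow> complex^'n \<Rightarrow> complex^'n" where
  "transition c d = snd d \<circ> inv_into (fst c) (snd c)"

definition overlap_image :: "('a, 'n::finite) chart \<Rightarrow> ('a, 'n) chart \<Rightarrow> (complex^'n) set" where
  "overlap_image c d = snd c ` (fst c \<inter> fst d)"

definition complex_manifold :: "'a topology \<Rightarrow> ('a, 'n::finite) chart set \<Rightarrow> bool" where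
  "complex_manifold X \<A> \<longleftrightarrow>
     Hausdorff_space X \<and> second_countable X \<and>
     (\<Union>c\<in>\<A>. fst c) = topspace X \<and>
     (\<forall>c\<in>\<A>. openin X (fst c) \<and> open (chart_image c) \<and>
        homeomorphic_map (subtopology X (fst c)) (top_of_set (chart_image c)) (snd c)) \<and>
     (\<forall>c\<in>\<A>. \<forall>d\<in>\<A>. holo_on (transition c d) (overlap_image c d))"

definition compact_complex_manifold :: "'a topology \<Rightarrow> ('a, 'n::finite) chart set \<Rightarrow> bool" where
  "compact_complex_manifold X \<A> \<longleftrightarrow> compact_space X \<and> complex_manifold X \<A>"

text \<open>\<open>jacobian c d x i j\<close> is the derivative, along the \<open>i\<close>-th frame vector of \<open>c\<close>, of the
  \<open>j\<close>-th coordinate of \<open>d\<close>.\<close>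

definition jacobian ::
    "('a, 'n::finite) chart \<Rightarrow> ('a, 'n) chart \<Rightarrow> complex^'n \<Rightarrow> 'n + 'n \<Rightarrow> 'n + 'n \<Rightarrow> complex" where
  "jacobian c d x i j = wirtinger i (coordinate j \<circ> transition c d) x"


section \<open>Exterior algebra in a coordinate frame\<close>

text \<open>
  A complex covector of degree \<open>k\<close> is given by its values \<open>u [i\<^sub>1, \<dots>, i\<^sub>k]\<close> on the
  complexified coordinate frame vectors. With the determinant convention used in \<open>wedge1\<close>,
  \<open>u = (1/k!) \<Sum>\<^sub>L u L dw\<^sup>L\<^sup>1 \<and> \<dots> \<and> dw\<^sup>L\<^sup>k\<close>, where \<open>dw\<^sup>i\<close> is \<open>dz\<^sup>s\<close> or its conjugate.
\<close>

type_synonym 'n covec = "('n + 'n) list \<Rightarrow> complex"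

definition alternating :: "'n::finite covec \<Rightarrow> bool" where
  "alternating u \<longleftrightarrow>
     (\<forall>L a b. a < length L \<and> b < length L \<and> a \<noteq> b \<longrightarrow> u (L[a := L ! b, b := L ! a]) = - u L)"

definition bidegree :: "nat \<Rightarrow> nat \<Rightarrow> 'n::finite covec \<Rightarrow> bool" where
  "bidegree p q u \<longleftrightarrow>
     (\<forall>L. u L \<noteq> 0 \<longrightarrow> length (filter isl L) = p \<and> length (filter (\<lambda>i. \<not> isl i) L) = q)"

definition dw :: "'n::finite + 'n \<Rightarrow> 'n covec" where
  "dw i L = (if L = [i] then 1 else 0)"

text \<open>Exterior product of a 1-covector with a covector.\<close>

definition wedge1 :: "'n::finite covec \<Rightarrow> 'n covec \<Rightarrow> 'n covec" where
  "wedge1 \<alpha> u L = (\<Sum>a<length L. (-1) ^ a * \<alpha> [L ! a] * u (take a L @ drop (Suc a) L))"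

text \<open>
  Contraction with a vector-valued 1-form \<open>\<Phi> = \<Sum>\<^sub>j \<Phi>\<^sup>j \<otimes> \<partial>\<^sub>j\<close>: the derivation of degree zero
  that sends \<open>dw\<^sup>j\<close> to \<open>\<Phi>\<^sup>j\<close>; see \<open>contract_dw\<close>, \<open>contract_scalar\<close> and \<open>contract_wedge1\<close> below.
\<close>

definition contract_at :: "('n::finite + 'n \<Rightarrow> 'n covec) \<Rightarrow> 'n covec \<Rightarrow> 'n covec" where
  "contract_at \<Phi> u L = (\<Sum>a<length L. \<Sum>j\<in>UNIV. \<Phi> j [L ! a] * u (L[a := j]))"

definition conj_at :: "'n::finite covec \<Rightarrow> 'n covec" where
  "conj_at u L = cnj (u (map bar L))"

lemma contract_scalar: "contract_at \<Phi> u [] = 0"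
  by (simp add: contract_at_def)

lemma contract_dw:
  fixes \<Phi> :: "'n::finite + 'n \<Rightarrow> 'n covec"
  assumes "\<And>L. length L \<noteq> 1 \<Longrightarrow> \<Phi> i L = 0"
  shows "contract_at \<Phi> (dw i) = \<Phi> i"
proof
  fix L :: "('n + 'n) list"
  show "contract_at \<Phi> (dw i) L = \<Phi> i L"
  proof (cases "length L = 1")
    case True
    then obtain k where "L = [k]" by (auto simp: length_Suc_conv)
    then show ?thesis
      by (simp add: contract_at_def dw_def if_distrib[of "\<lambda>x. _ * x"] cong: if_cong)
  next
    case False
    then have "dw i (L[a := j]) = 0" for a j
      by (metis dw_def length_Cons length_list_update list.size(3) One_nat_def)
    then show ?thesis using False assms by (simp add: contract_at_def)
  qed
qed

lemma contract_wedge1: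
  fixes \<Phi> :: "'n::finite + 'n \<Rightarrow> 'n covec"
  shows "contract_at \<Phi> (wedge1 \<alpha> u) L =
         wedge1 (contract_at \<Phi> \<alpha>) u L + wedge1 \<alpha> (contract_at \<Phi> u) L"
proof -
  define n where "n = length L"
  define rm where "rm a M = take a M @ drop (Suc a) M" for a and M :: "('n + 'n) list"
  define sk where "sk a b = (if b < a then b else Suc b)" for a b :: nat
  define g where "g a b =
    (\<Sum>j\<in>UNIV. \<Phi> j [L ! b] * (\<alpha> [L[b := j] ! a] * u (rm a (L[b := j]))))" for a b
  have "contract_at \<Phi> (wedge1 \<alpha> u) L = (\<Sum>b<n. \<Sum>j\<in>UNIV. \<Sum>a<n. (-1) ^ a *
      (\<Phi> j [L ! b] * (\<alpha> [L[b := j] ! a] * u (rm a (L[b := j])))))"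
    by (simp add: contract_at_def wedge1_def n_def rm_def sum_distrib_left mult_ac)
  also have "\<dots> = (\<Sum>b<n. \<Sum>a<n. \<Sum>j\<in>UNIV. (-1) ^ a *
      (\<Phi> j [L ! b] * (\<alpha> [L[b := j] ! a] * u (rm a (L[b := j])))))"
    by (intro sum.cong refl sum.swap)
  also have "\<dots> = (\<Sum>a<n. \<Sum>b<n. (-1) ^ a * g a b)"
    by (subst sum.swap) (simp add: g_def sum_distrib_left)
  also have "\<dots> = (\<Sum>a<n. (-1) ^ a * (\<Sum>b<n. g a b))"
    by (simp add: sum_distrib_left)
  finally have 1: "contract_at \<Phi> (wedge1 \<alpha> u) L = (\<Sum>a<n. (-1) ^ a * (\<Sum>b<n. g a b))" .
  have 2: "(\<Sum>b<n. g a b) =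
      contract_at \<Phi> \<alpha> [L ! a] * u (rm a L) + \<alpha> [L ! a] * contract_at \<Phi> u (rm a L)"
    if a: "a < n" for a
  proof -
    have "(\<Sum>b<n. g a b) = g a a + (\<Sum>b\<in>{..<n} - {a}. g a b)"
      using a by (simp add: sum.remove)
    moreover have "g a a = contract_at \<Phi> \<alpha> [L ! a] * u (rm a L)"
      using a by (simp add: g_def contract_at_def n_def rm_def sum_distrib_right mult.assoc)
    moreover have "(\<Sum>b\<in>{..<n} - {a}. g a b) = (\<Sum>b<n - 1. g a (sk a b))"
    proof (rule sum.reindex_bij_witness[where i = "sk a" and j = "\<lambda>b. if b < a then b else b - 1"])
    qed (use a in \<open>auto simp: sk_def\<close>)
    moreover have "g a (sk a b) =
        \<alpha> [L ! a] * (\<Sum>j\<in>UNIV. \<Phi> j [rm a L ! b] * u ((rm a L)[b := j]))"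
      if b: "b < n - 1" for b
    proof -
      have "L ! sk a b = rm a L ! b"
        using a b by (auto simp: sk_def rm_def n_def nth_append)
      moreover have "L[sk a b := j] ! a = L ! a" for j
        by (simp add: sk_def)
      moreover have "rm a (L[sk a b := j]) = (rm a L)[b := j]" for j
        using a b
        by (intro nth_equalityI)
           (auto simp: sk_def rm_def n_def nth_append nth_list_update)
      ultimately show ?thesis
        by (simp add: g_def sum_distrib_left mult_ac)
    qed
    moreover have "length (rm a L) = n - 1"
      using a by (simp add: rm_def n_def)
    ultimately show ?thesis
      by (simp add: contract_at_def[of \<Phi> u] sum_distrib_left)
  qed
  have "(\<Sum>a<n. (-1) ^ a * (\<Sum>b<n. g a b)) =
      (\<Sum>a<n. (-1) ^ a * (contract_at \<Phi> \<alpha> [L ! a] * u (rm a L) +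
        \<alpha> [L ! a] * contract_at \<Phi> u (rm a L)))"
    using 2 by (intro sum.cong) auto
  then show ?thesis
    unfolding 1
    by (simp add: wedge1_def n_def rm_def sum.distrib distrib_left mult.assoc)
qed


section \<open>Differential forms and vector-valued forms\<close>

text \<open>Both are given by their components in every chart, as functions of the coordinates.
  A vector-valued form \<open>\<Sum>\<^sub>j \<Phi>\<^sup>j \<otimes> \<partial>\<^sub>j\<close> has the components \<open>\<Phi> c j\<close>.\<close>

type_synonym ('a, 'n) form = "('a, 'n) chart \<Rightarrow> complex^'n \<Rightarrow> 'n covec"
type_synonym ('a, 'n) vform = "('a, 'n) chart \<Rightarrow> 'n + 'n \<Rightarrow> complex^'n \<Rightarrow> 'n covec"

text \<open>Change of frame from \<open>d\<close> to \<open>c\<close> for the values of a covector \<open>u\<close> given in \<open>d\<close>.\<close>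

definition pull_covec ::
    "('a, 'n) chart \<Rightarrow> ('a, 'n) chart \<Rightarrow> complex^'n \<Rightarrow> 'n::finite covec \<Rightarrow> 'n covec" where
  "pull_covec c d x u L = (\<Sum>M | length M = length L.
     (\<Prod>a<length L. jacobian c d x (L ! a) (M ! a)) * u M)"

definition pq_form :: "('a, 'n) chart set \<Rightarrow> nat \<Rightarrow> nat \<Rightarrow> ('a, 'n::finite) form \<Rightarrow> bool" where
  "pq_form \<A> p q \<omega> \<longleftrightarrow>
     (\<forall>c\<in>\<A>. \<forall>L. smooth_on (\<lambda>x. \<omega> c x L) (chart_image c)) \<and>
     (\<forall>c\<in>\<A>. \<forall>x\<in>chart_image c. alternating (\<omega> c x) \<and> bidegree p q (\<omega> c x)) \<and>
     (\<forall>c\<in>\<A>. \<forall>d\<in>\<A>. \<forall>x\<in>overlap_image c d.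
        \<omega> c x = pull_covec c d x (\<omega> d (transition c d x)))"

text \<open>Smooth (0,1)-forms with values in the holomorphic tangent bundle. The compatibility
  condition compares the components along the frame of the second chart.\<close>

definition beltrami :: "('a, 'n) chart set \<Rightarrow> ('a, 'n::finite) vform \<Rightarrow> bool" where
  "beltrami \<A> \<Phi> \<longleftrightarrow>
     (\<forall>c\<in>\<A>. \<forall>j L. smooth_on (\<lambda>x. \<Phi> c j x L) (chart_image c)) \<and>
     (\<forall>c\<in>\<A>. \<forall>x\<in>chart_image c.
        (\<forall>s. bidegree 0 1 (\<Phi> c (Inl s) x)) \<and> (\<forall>s. \<Phi> c (Inr s) x = 0)) \<and>
     (\<forall>c\<in>\<A>. \<forall>d\<in>\<A>. \<forall>x\<in>overlap_image c d. \<forall>m L.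
        (\<Sum>j\<in>UNIV. jacobian c d x j m * \<Phi> c j x L) =
        pull_covec c d x (\<Phi> d m (transition c d x)) L)"

text \<open>Equality on the manifold: values off the chart images are ignored.\<close>

definition form_eq :: "('a, 'n::finite) chart set \<Rightarrow> ('a, 'n) form \<Rightarrow> ('a, 'n) form \<Rightarrow> bool" where
  "form_eq \<A> \<omega> \<eta> \<longleftrightarrow> (\<forall>c\<in>\<A>. \<forall>x\<in>chart_image c. \<omega> c x = \<eta> c x)"

definition vform_eq :: "('a, 'n::finite) chart set \<Rightarrow> ('a, 'n) vform \<Rightarrow> ('a, 'n) vform \<Rightarrow> bool" where
  "vform_eq \<A> \<Phi> \<Psi> \<longleftrightarrow> (\<forall>c\<in>\<A>. \<forall>x\<in>chart_image c. \<forall>j. \<Phi> c j x = \<Psi> c j x)"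

definition pd_covec :: "'n::finite + 'n \<Rightarrow> (complex^'n \<Rightarrow> 'n covec) \<Rightarrow> complex^'n \<Rightarrow> 'n covec" where
  "pd_covec i u x L = wirtinger i (\<lambda>y. u y L) x"

definition del_loc :: "(complex^'n \<Rightarrow> 'n::finite covec) \<Rightarrow> complex^'n \<Rightarrow> 'n covec" where
  "del_loc u x = (\<Sum>s\<in>UNIV. wedge1 (dw (Inl s)) (pd_covec (Inl s) u x))"

definition delbar_loc :: "(complex^'n \<Rightarrow> 'n::finite covec) \<Rightarrow> complex^'n \<Rightarrow> 'n covec" where
  "delbar_loc u x = (\<Sum>s\<in>UNIV. wedge1 (dw (Inr s)) (pd_covec (Inr s) u x))"

definition del :: "('a, 'n::finite) form \<Rightarrow> ('a, 'n) form" where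
  "del \<omega> c = del_loc (\<omega> c)"

definition delbar :: "('a, 'n::finite) form \<Rightarrow> ('a, 'n) form" where
  "delbar \<omega> c = delbar_loc (\<omega> c)"

definition vdelbar :: "('a, 'n::finite) vform \<Rightarrow> ('a, 'n) vform" where
  "vdelbar \<Phi> c j = delbar_loc (\<Phi> c j)"

definition conj_form :: "('a, 'n::finite) form \<Rightarrow> ('a, 'n) form" where
  "conj_form \<omega> c x = conj_at (\<omega> c x)"

definition conj_vform :: "('a, 'n::finite) vform \<Rightarrow> ('a, 'n) vform" where
  "conj_vform \<Phi> c j x = conj_at (\<Phi> c (bar j) x)"

definition contract :: "('a, 'n::finite) vform \<Rightarrow> ('a, 'n) form \<Rightarrow> ('a, 'n) form" where
  "contract \<Phi> \<omega> c x = contract_at (\<lambda>j. \<Phi> c j x) (\<omega> c x)"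

text \<open>Contraction of the form part of \<open>\<Psi>\<close> with \<open>\<Phi>\<close>.\<close>

definition vcontract :: "('a, 'n::finite) vform \<Rightarrow> ('a, 'n) vform \<Rightarrow> ('a, 'n) vform" where
  "vcontract \<Phi> \<Psi> c k x = contract_at (\<lambda>j. \<Phi> c j x) (\<Psi> c k x)"

definition bracket :: "('a, 'n::finite) vform \<Rightarrow> ('a, 'n) vform \<Rightarrow> ('a, 'n) vform" where
  "bracket \<Phi> \<Psi> c j x = (\<Sum>i\<in>UNIV.
     wedge1 (\<Phi> c (Inl i) x) (pd_covec (Inl i) (\<Psi> c j) x) +
     wedge1 (\<Psi> c (Inl i) x) (pd_covec (Inl i) (\<Phi> c j) x))"


section \<open>Families of Beltrami differentials\<close>

text \<open>Smooth jointly in the point and the parameter, and holomorphic in the parameter.\<close>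

definition holomorphic_family ::
    "('a, 'n) chart set \<Rightarrow> real \<Rightarrow> (complex \<Rightarrow> ('a, 'n::finite) vform) \<Rightarrow> bool" where
  "holomorphic_family \<A> r \<Phi> \<longleftrightarrow>
     (\<forall>t\<in>ball 0 r. beltrami \<A> (\<Phi> t)) \<and>
     (\<forall>c\<in>\<A>. \<forall>j L. smooth_on (\<lambda>(x, t). \<Phi> t c j x L) (chart_image c \<times> ball 0 r)) \<and>
     (\<forall>c\<in>\<A>. \<forall>x\<in>chart_image c. \<forall>j L. (\<lambda>t. \<Phi> t c j x L) holomorphic_on ball 0 r)"

text \<open>\<open>\<Phi> t = \<Sum>\<^sub>i\<^sub>\<ge>\<^sub>1 \<phi>\<^sub>i t\<^sup>i\<close>; the value \<open>\<phi> 0\<close> plays no role.\<close>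

definition power_series_of ::
    "('a, 'n) chart set \<Rightarrow> real \<Rightarrow> (complex \<Rightarrow> ('a, 'n::finite) vform) \<Rightarrow>
     (nat \<Rightarrow> ('a, 'n) vform) \<Rightarrow> bool" where
  "power_series_of \<A> r \<Phi> \<phi> \<longleftrightarrow>
     (\<forall>i\<ge>1. beltrami \<A> (\<phi> i)) \<and>
     (\<forall>t\<in>ball 0 r. \<forall>c\<in>\<A>. \<forall>x\<in>chart_image c. \<forall>j L.
        (\<lambda>i. \<phi> (Suc i) c j x L * t ^ Suc i) sums \<Phi> t c j x L)"

definition integrable_family ::
    "('a, 'n) chart set \<Rightarrow> real \<Rightarrow> (complex \<Rightarrow> ('a, 'n::finite) vform) \<Rightarrow> bool" where
  "integrable_family \<A> r \<Phi> \<longleftrightarrow>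
     (\<forall>t\<in>ball 0 r.
        vform_eq \<A> (vdelbar (\<Phi> t)) (\<lambda>c j x L. 1 / 2 * bracket (\<Phi> t) (\<Phi> t) c j x L))"


section \<open>Formal power series in the parameter and its conjugate\<close>

text \<open>\<open>\<alpha> i j\<close> is the coefficient of \<open>t\<^sup>i\<close> times the \<open>j\<close>-th power of the conjugate of \<open>t\<close>.
  Sums and differences of series are the pointwise ones of \<open>Function_Algebras\<close>.\<close>

type_synonym 'b series = "nat \<Rightarrow> nat \<Rightarrow> 'b"

definition smap :: "('b \<Rightarrow> 'c) \<Rightarrow> 'b series \<Rightarrow> 'c series" where
  "smap D \<alpha> i j = D (\<alpha> i j)"

definition sprod ::
    "('b \<Rightarrow> 'c \<Rightarrow> 'd::comm_monoid_add) \<Rightarrow> 'b series \<Rightarrow> 'c series \<Rightarrow> 'd series" where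
  "sprod B \<alpha> \<beta> i j = (\<Sum>a\<le>i. \<Sum>b\<le>j. B (\<alpha> a b) (\<beta> (i - a) (j - b)))"

text \<open>\<open>C\<close> is the conjugation of coefficients.\<close>

definition sconj :: "('b \<Rightarrow> 'c) \<Rightarrow> 'b series \<Rightarrow> 'c series" where
  "sconj C \<alpha> i j = C (\<alpha> j i)"

definition hom_part :: "nat \<Rightarrow> 'b::zero series \<Rightarrow> 'b series" where
  "hom_part k \<alpha> i j = (if i + j = k then \<alpha> i j else 0)"

definition holo_series :: "(nat \<Rightarrow> 'b::zero) \<Rightarrow> 'b series" where
  "holo_series \<phi> i j = (if i \<ge> 1 \<and> j = 0 then \<phi> i else 0)"

definition series_eq ::
    "('a, 'n::finite) chart set \<Rightarrow> ('a, 'n) form series \<Rightarrow> ('a, 'n) form series \<Rightarrow> bool" where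
  "series_eq \<A> \<alpha> \<beta> \<longleftrightarrow> (\<forall>i j. form_eq \<A> (\<alpha> i j) (\<beta> i j))"

definition eq_up_to ::
    "('a, 'n::finite) chart set \<Rightarrow> nat \<Rightarrow> ('a, 'n) form series \<Rightarrow> ('a, 'n) form series \<Rightarrow> bool" where
  "eq_up_to \<A> N \<alpha> \<beta> \<longleftrightarrow> (\<forall>k\<le>N. series_eq \<A> (hom_part k \<alpha>) (hom_part k \<beta>))"

definition real_series :: "('a, 'n::finite) chart set \<Rightarrow> ('a, 'n) form series \<Rightarrow> bool" where
  "real_series \<A> \<omega> \<longleftrightarrow> series_eq \<A> (sconj conj_form \<omega>) \<omega>"

abbreviation sdel :: "('a, 'n::finite) form series \<Rightarrow> ('a, 'n) form series" where
  "sdel \<equiv> smap del"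

abbreviation sdelbar :: "('a, 'n::finite) form series \<Rightarrow> ('a, 'n) form series" where
  "sdelbar \<equiv> smap delbar"

abbreviation scontract ::
    "('a, 'n::finite) vform series \<Rightarrow> ('a, 'n) form series \<Rightarrow> ('a, 'n) form series"
    (infixr "\<rightharpoondown>" 75) where
  "\<Phi> \<rightharpoondown> \<omega> \<equiv> sprod contract \<Phi> \<omega>"

abbreviation svcontract ::
    "('a, 'n::finite) vform series \<Rightarrow> ('a, 'n) vform series \<Rightarrow> ('a, 'n) vform series"
    (infixr "\<rightharpoondown>\<^sub>v" 75) where
  "\<Phi> \<rightharpoondown>\<^sub>v \<Psi> \<equiv> sprod vcontract \<Phi> \<Psi>"

definition commutator :: "('b \<Rightarrow> 'b) \<Rightarrow> ('b \<Rightarrow> 'b) \<Rightarrow> 'b \<Rightarrow> 'b::minus" where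
  "commutator D I \<alpha> = D (I \<alpha>) - I (D \<alpha>)"

end

theory Submission
  imports Defs "HOL-Complex_Analysis.Complex_Analysis"
begin

text \<open>
  Write \<open>i\<close> for contraction with \<open>\<phi>\<close>, \<open>i'\<close> for contraction with its conjugate, \<open>A\<close> and \<open>B\<close>
  for contraction with the two products, so that \<open>[i, i'] = A - B\<close> and \<open>[i, A + B] = 0\<close>, and
  \<open>\<partial>'\<close> for \<open>delbar\<close>. Let \<open>R\<^sub>1\<close>, \<open>R\<^sub>2\<close> be the differences of the two sides of the given system.
  Integrability amounts to \<open>[\<partial>', i] = H\<close> with \<open>-2 H = [[\<partial>, i], i]\<close> and \<open>[H, i] = 0\<close>. Together
  with \<open>i i \<omega> = 0\<close>, \<open>i i A \<omega> = 0\<close> and \<open>i i i' \<omega> = 2 i A \<omega>\<close>, which follow by counting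
  bidegrees, these give the exact identities
  \<open>6 \<partial>' i \<omega> = 6 i R\<^sub>1 - 3 i i R\<^sub>2 + i i i \<partial> i' \<omega>\<close> and
  \<open>2 ([\<partial>, i] + \<partial>') (\<omega> - A \<omega>) = 2 R\<^sub>1 - 2 i R\<^sub>2 + i i \<partial> i' \<omega>\<close>, and likewise their conjugates.
  Every contraction raises the order in \<open>t\<close> by one. Hence the first identity and its conjugate
  bound the orders of \<open>\<partial>' i \<omega>\<close> and \<open>\<partial> i' \<omega>\<close> in terms of each other, and by induction both
  vanish up to degree \<open>N + 1\<close>; the second identity then gives the second system.
\<close>

section \<open>Multilinear algebra over a commutative ring\<close>

text \<open>Over the ring of power series in \<open>t\<close> and its conjugate, the convolution \<open>sprod\<close> becomes
  multiplication, so \<open>contract_at\<close> and \<open>wedge1\<close> are needed with coefficients in a general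
  ring. Recursion on the argument list makes their identities simple inductions.\<close>

fun ract :: "('i::finite \<Rightarrow> 'i \<Rightarrow> 'r::comm_ring_1) \<Rightarrow> ('i list \<Rightarrow> 'r) \<Rightarrow> 'i list \<Rightarrow> 'r" where
  "ract M u [] = 0"
| "ract M u (k # L) = (\<Sum>j\<in>UNIV. M j k * u (j # L)) + ract M (\<lambda>L. u (k # L)) L"

fun rwedge :: "('i \<Rightarrow> 'r::comm_ring_1) \<Rightarrow> ('i list \<Rightarrow> 'r) \<Rightarrow> 'i list \<Rightarrow> 'r" where
  "rwedge \<alpha> u [] = 0"
| "rwedge \<alpha> u (k # L) = \<alpha> k * u L - rwedge \<alpha> (\<lambda>L. u (k # L)) L"

lemma contract_at_eq_ract: "contract_at \<Psi> u L = ract (\<lambda>j k. \<Psi> j [k]) u L"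
proof (induction L arbitrary: u)
  case (Cons k L)
  then show ?case
    by (simp add: contract_at_def sum.lessThan_Suc_shift del: sum.lessThan_Suc flip: Cons.IH)
qed (simp add: contract_at_def)

lemma wedge1_eq_rwedge: "wedge1 \<alpha> u L = rwedge (\<lambda>k. \<alpha> [k]) u L"
proof (induction L arbitrary: u)
  case (Cons k L)
  then show ?case
    by (simp add: wedge1_def sum.lessThan_Suc_shift sum_negf del: sum.lessThan_Suc flip: Cons.IH)
qed (simp add: wedge1_def)

lemma ract_add: "ract M (\<lambda>L. u L + v L) L = ract M u L + ract M v L"
  by (induction L arbitrary: u v) (simp_all add: algebra_simps sum.distrib)

lemma ract_diff: "ract M (\<lambda>L. u L - v L) L = ract M u L - ract M v L"
  by (induction L arbitrary: u v) (simp_all add: algebra_simps sum_subtractf)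

lemma ract_mult: "ract M (\<lambda>L. c * u L) L = c * ract M u L"
  by (induction L arbitrary: u) (simp_all add: algebra_simps sum_distrib_left)

lemma ract_zero: "ract M (\<lambda>L. 0) L = 0"
  by (induction L) simp_all

lemma ract_sum: "ract M (\<lambda>L. \<Sum>s\<in>T. u s L) L = (\<Sum>s\<in>T. ract M (u s) L)"
  by (induction T rule: infinite_finite_induct) (simp_all add: ract_zero ract_add)

lemma ract_zero_left: "ract (\<lambda>j k. 0) u L = 0"
  by (induction L arbitrary: u) simp_all

lemma ract_add_left: "ract (\<lambda>j k. M j k + N j k) u L = ract M u L + ract N u L"
  by (induction L arbitrary: u) (simp_all add: algebra_simps sum.distrib)

lemma ract_diff_left: "ract (\<lambda>j k. M j k - N j k) u L = ract M u L - ract N u L"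
  by (induction L arbitrary: u) (simp_all add: algebra_simps sum_subtractf)

lemma rwedge_add: "rwedge \<alpha> (\<lambda>L. u L + v L) L = rwedge \<alpha> u L + rwedge \<alpha> v L"
  by (induction L arbitrary: u v) (simp_all add: algebra_simps)

lemma rwedge_diff: "rwedge \<alpha> (\<lambda>L. u L - v L) L = rwedge \<alpha> u L - rwedge \<alpha> v L"
  by (induction L arbitrary: u v) (simp_all add: algebra_simps)

lemma rwedge_mult: "rwedge \<alpha> (\<lambda>L. c * u L) L = c * rwedge \<alpha> u L"
  by (induction L arbitrary: u) (simp_all add: algebra_simps)

lemma rwedge_zero: "rwedge \<alpha> (\<lambda>L. 0) L = 0"
  by (induction L) simp_all

lemma rwedge_sum: "rwedge \<alpha> (\<lambda>L. \<Sum>s\<in>T. u s L) L = (\<Sum>s\<in>T. rwedge \<alpha> (u s) L)"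
  by (induction T rule: infinite_finite_induct) (simp_all add: rwedge_zero rwedge_add)

lemma rwedge_mult_left: "rwedge (\<lambda>k. c * \<alpha> k) u L = c * rwedge \<alpha> u L"
  by (induction L arbitrary: u) (simp_all add: algebra_simps)

lemma rwedge_zero_left: "rwedge (\<lambda>k. 0) u L = 0"
  by (induction L arbitrary: u) simp_all

lemma rwedge_add_left: "rwedge (\<lambda>k. \<alpha> k + \<beta> k) u L = rwedge \<alpha> u L + rwedge \<beta> u L"
  by (induction L arbitrary: u) (simp_all add: algebra_simps)

lemma rwedge_sum_left: "rwedge (\<lambda>k. \<Sum>s\<in>T. \<alpha> s k) u L = (\<Sum>s\<in>T. rwedge (\<alpha> s) u L)"
  by (induction T rule: infinite_finite_induct) (simp_all add: rwedge_zero_left rwedge_add_left)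

text \<open>Contraction is a derivation of degree zero and acts on each factor in turn; the covector
  in the first term is \<alpha> contracted with \<open>M\<close>.\<close>

lemma ract_rwedge:
  "ract M (rwedge \<alpha> u) L = rwedge (\<lambda>k. \<Sum>j\<in>UNIV. M j k * \<alpha> j) u L + rwedge \<alpha> (ract M u) L"
proof (induction L arbitrary: u)
  case (Cons k L)
  then show ?case
    by (simp add: ract_diff ract_mult rwedge_add rwedge_sum rwedge_mult Cons.IH
        sum_subtractf sum_distrib_right right_diff_distrib mult.assoc)
qed simp

text \<open>The terms in which \<open>M\<close> and \<open>N\<close> act on different slots cancel.
  What remains acts on a single slot, so the commutator of two contractions is the contraction with
  the commutator of their matrices.\<close>

lemma ract_commutator:
  fixes M N :: "'i::finite \<Rightarrow> 'i \<Rightarrow> 'r::comm_ring_1"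
  shows "ract M (ract N u) L - ract N (ract M u) L =
   ract (\<lambda>j k. (\<Sum>l\<in>UNIV. M l k * N j l) - (\<Sum>l\<in>UNIV. N l k * M j l)) u L"
proof (induction L arbitrary: u)
  case (Cons k L)
  have *: "(\<Sum>j\<in>UNIV. M' j k * (\<Sum>l\<in>UNIV. N' l j * u (l # L))) =
      (\<Sum>j\<in>UNIV. (\<Sum>l\<in>UNIV. M' l k * N' j l) * u (j # L))" for M' N' :: "'i \<Rightarrow> 'i \<Rightarrow> 'r"
    by (simp add: sum_distrib_left sum_distrib_right) (subst sum.swap, simp add: mult_ac)
  show ?case
    by (simp add: ract_add ract_sum ract_mult sum.distrib distrib_left left_diff_distrib
        sum_subtractf * flip: Cons.IH)
qed simp

lemma rwedge_anticommute: "rwedge \<alpha> (rwedge \<beta> u) L = - rwedge \<beta> (rwedge \<alpha> u) L"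
  by (induction L arbitrary: u) (simp_all add: rwedge_diff rwedge_mult)

section \<open>Alternating covectors\<close>

definition ralt :: "('i list \<Rightarrow> 'r::comm_ring_1) \<Rightarrow> bool" where
  "ralt u \<longleftrightarrow> (\<forall>K a b L. u (K @ a # b # L) = - u (K @ b # a # L))"

lemma raltD: "ralt u \<Longrightarrow> u (K @ a # b # L) = - u (K @ b # a # L)"
  unfolding ralt_def by blast

lemma ralt_Cons: "ralt u \<Longrightarrow> ralt (\<lambda>L. u (k # L))"
  unfolding ralt_def by (metis append_Cons)

text \<open>Only a swap at the head needs an argument: there the terms in which \<open>M\<close>
  hits the first and the second slot of the pair are exchanged, and the tail follows by linearity. A
  longer prefix is handled by freezing its first argument.\<close>

lemma ralt_ract:
  assumes "ralt u"
  shows "ralt (ract M u)"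
proof -
  have "ract M u (K @ a # b # L) = - ract M u (K @ b # a # L)" for K a b L
    using assms
  proof (induction K arbitrary: u)
    case Nil
    have s: "u (a # b # L) = - u (b # a # L)" for a b L
      using raltD[OF Nil, of "[]" a b L] by simp
    have "(\<lambda>L. u (a # b # L)) = (\<lambda>L. (-1) * u (b # a # L))"
      by (intro ext) (subst s, simp)
    then have t: "ract M (\<lambda>L. u (a # b # L)) L = (-1) * ract M (\<lambda>L. u (b # a # L)) L"
      by (simp only: ract_mult)
    have "(\<Sum>j\<in>UNIV. M j k * u (j # l # L)) = - (\<Sum>j\<in>UNIV. M j k * u (l # j # L))" for k l
      by (simp add: s[of _ l L] sum_negf)
    from this[of a b] this[of b a] show ?case
      by (simp add: t)
  next
    case (Cons k K)
    have "u (j # K @ a # b # L) = - u (j # K @ b # a # L)" for j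
      using raltD[OF Cons.prems, of "j # K" a b L] by simp
    then have "(\<Sum>j\<in>UNIV. M j k * u (j # K @ a # b # L)) =
        - (\<Sum>j\<in>UNIV. M j k * u (j # K @ b # a # L))"
      by (simp only: mult_minus_right sum_negf)
    moreover have "ract M (\<lambda>L. u (k # L)) (K @ a # b # L) = - ract M (\<lambda>L. u (k # L)) (K @ b # a # L)"
      by (rule Cons.IH[OF ralt_Cons[OF Cons.prems]])
    ultimately show ?case
      by (simp only: append_Cons ract.simps minus_add_distrib)
  qed
  then show ?thesis unfolding ralt_def by blast
qed

text \<open>The interior product with the \<open>j\<close>-th frame vector prepends \<open>j\<close> to the argument list.\<close>

lemma ract_eq_rwedge:
  assumes "ralt u"
  shows "ract M u L = (\<Sum>j\<in>UNIV. rwedge (M j) (\<lambda>L. u (j # L)) L)"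
  using assms
proof (induction L arbitrary: u)
  case (Cons k L)
  have "(\<lambda>L. u (j # k # L)) = (\<lambda>L. (-1) * u (k # j # L))" for j
    using raltD[OF Cons.prems, of "[]" j k] by auto
  then have "rwedge (M j) (\<lambda>L. u (j # k # L)) L = (-1) * rwedge (M j) (\<lambda>L. u (k # j # L)) L" for j
    by (simp only: rwedge_mult)
  then show ?case
    by (simp add: Cons.IH[OF ralt_Cons[OF Cons.prems]] sum.distrib sum_subtractf sum_negf)
qed simp

section \<open>Counting the arguments that lie in a set of indices\<close>

lemma ract_nonzeroE:
  assumes "ract M u L \<noteq> 0"
  obtains K j k K' where "L = K @ k # K'" "M j k \<noteq> 0" "u (K @ j # K') \<noteq> 0"
  using assms
proof (induction L arbitrary: u thesis)
  case (Cons k L)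
  show ?case
  proof (cases "ract M (\<lambda>L. u (k # L)) L = 0")
    case True
    then have "(\<Sum>j\<in>UNIV. M j k * u (j # L)) \<noteq> 0"
      using Cons.prems(2) by simp
    then obtain j where "M j k * u (j # L) \<noteq> 0"
      by (metis (no_types, lifting) sum.neutral)
    then show thesis
      by (intro Cons.prems(1)[of "[]" k L j]) auto
  next
    case False
    show thesis
    proof (rule Cons.IH[OF _ False])
      fix K j l K'
      assume "L = K @ l # K'" "M j l \<noteq> 0" "u (k # K @ j # K') \<noteq> 0"
      then show thesis
        by (intro Cons.prems(1)[of "k # K" l K' j]) auto
    qed
  qed
qed simp

text \<open>For \<open>S = range Inl\<close> this fixes the holomorphic degree and for
  \<open>S = range Inr\<close> the antiholomorphic one. Leaving \<open>S\<close> open lets one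
  argument serve an equation and its conjugate.\<close>

definition rsupp :: "'i set \<Rightarrow> nat \<Rightarrow> ('i list \<Rightarrow> 'r::comm_ring_1) \<Rightarrow> bool" where
  "rsupp S p u \<longleftrightarrow> (\<forall>L. u L \<noteq> 0 \<longrightarrow> length (filter (\<lambda>i. i \<in> S) L) = p)"

text \<open>Each nonzero term trades one argument in \<open>S\<close> for one outside it, as
  contraction with a Beltrami differential does with a \<open>dz\<close>.\<close>

lemma rsupp_ract_lower:
  assumes u: "rsupp S (Suc p) u" and M: "\<And>j k. M j k \<noteq> 0 \<Longrightarrow> j \<in> S \<and> k \<notin> S"
  shows "rsupp S p (ract M u)"
  unfolding rsupp_def
proof (intro allI impI)
  fix L assume "ract M u L \<noteq> 0"
  then obtain K j k K' where L: "L = K @ k # K'" "M j k \<noteq> 0" "u (K @ j # K') \<noteq> 0"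
    by (rule ract_nonzeroE)
  have "length (filter (\<lambda>i. i \<in> S) (K @ j # K')) = Suc p"
    using u L(3) unfolding rsupp_def by blast
  then show "length (filter (\<lambda>i. i \<in> S) L) = p"
    using M[OF L(2)] L(1) by simp
qed

lemma rsupp_ract_same:
  assumes u: "rsupp S p u" and M: "\<And>j k. M j k \<noteq> 0 \<Longrightarrow> j \<in> S \<longleftrightarrow> k \<in> S"
  shows "rsupp S p (ract M u)"
  unfolding rsupp_def
proof (intro allI impI)
  fix L assume "ract M u L \<noteq> 0"
  then obtain K j k K' where L: "L = K @ k # K'" "M j k \<noteq> 0" "u (K @ j # K') \<noteq> 0"
    by (rule ract_nonzeroE)
  have "length (filter (\<lambda>i. i \<in> S) (K @ j # K')) = p"
    using u L(3) unfolding rsupp_def by blast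
  then show "length (filter (\<lambda>i. i \<in> S) L) = p"
    using M[OF L(2)] L(1) by (simp split: if_splits)
qed

text \<open>With no index of \<open>S\<close> present there is nothing for \<open>M\<close> to
  replace.\<close>

lemma ract_rsupp_0:
  assumes u: "rsupp S 0 u" and M: "\<And>j k. M j k \<noteq> 0 \<Longrightarrow> j \<in> S"
  shows "ract M u L = 0"
proof (rule ccontr)
  assume "ract M u L \<noteq> 0"
  then obtain K j k K' where L: "L = K @ k # K'" "M j k \<noteq> 0" "u (K @ j # K') \<noteq> 0"
    by (rule ract_nonzeroE)
  then show False
    using u M[OF L(2)] unfolding rsupp_def by fastforce
qed

section \<open>Commutation relations at a point\<close>

text \<open>The bookkeeping behind both identities, free of analysis. Elements of \<open>'f\<close>
  are form series near a point and elements of \<open>'v\<close> their values at it;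
  \<open>v\<close> evaluates, \<open>D\<close> and \<open>D'\<close> give the values of the two
  differentials, and \<open>i\<close> and \<open>I\<close> are the same contraction on series and on
  values. \<open>a\<close> and \<open>th\<close> stand for \<open>A\<close> and \<open>i'\<close>
  applied to \<open>w\<close>. All relations are scaled so that no division in \<open>'v\<close>
  occurs.\<close>

lemma second_order_identities:
  fixes I H :: "'v::comm_ring_1 \<Rightarrow> 'v" and v D D' :: "'f \<Rightarrow> 'v" and i :: "'f \<Rightarrow> 'f"
  assumes add: "\<And>x y. I (x + y) = I x + I y"
    and comm: "\<And>x. H (I x) = I (H x)"
    and good: "\<And>f. f \<in> G \<Longrightarrow> i f \<in> G" "w \<in> G" "a \<in> G" "th \<in> G"
    and v: "\<And>f. f \<in> G \<Longrightarrow> v (i f) = I (v f)"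
    and D': "\<And>f. f \<in> G \<Longrightarrow> D' (i f) = I (D' f) + H (v f)"
    and D: "\<And>f. f \<in> G \<Longrightarrow> D (i (i f)) + I (I (D f)) + 2 * H (v f) = 2 * I (D (i f))"
    and w: "D (i (i w)) = 0" and a: "D (i (i a)) = 0" and th: "D (i (i (i th))) = 0"
    and th2: "D (i (i th)) = 2 * D (i a)" "D' (i (i th)) = 2 * D' (i a)"
    and R1: "R1 = D' w - D' a + D' (i th) + D (i w)"
    and R2: "R2 = D w - D a + D (i th) + D' th"
  shows "6 * D' (i w) = 6 * I R1 - 3 * I (I R2) + I (I (I (D th)))"
    and "2 * (D (i w) - D (i a) - I (D w - D a) + (D' w - D' a)) =
         2 * R1 - 2 * I R2 + I (I (D th))"
proof -
  have zero: "I 0 = 0"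
    using add[of 0 0] by simp
  have minus: "I (x - y) = I x - I y" for x y
    using add[of "x - y" y] by (metis add_diff_cancel_right' diff_add_cancel)
  have two: "I (2 * x) = 2 * I x" for x
    unfolding mult_2 add ..
  note lin = add minus two zero
  define h where "h f = H (v f)" for f
  have Ih: "I (h f) = h (i f)" if "f \<in> G" for f
    using that by (simp add: h_def v comm)
  have D'h: "D' (i f) = I (D' f) + h f" if "f \<in> G" for f
    using D' that by (simp add: h_def)
  have Dh: "D (i (i f)) + I (I (D f)) + 2 * h f = 2 * I (D (i f))" if "f \<in> G" for f
    using D that by (simp add: h_def)
  have IDh: "I (D (i (i f))) + I (I (I (D f))) + 2 * h (i f) = 2 * I (I (D (i f)))"
    if "f \<in> G" for f
    using arg_cong[OF Dh[OF that], of I] Ih[OF that] by (simp add: lin)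
  have ID'h: "I (D' (i f)) = I (I (D' f)) + h (i f)" if "f \<in> G" for f
    using arg_cong[OF D'h[OF that], of I] Ih[OF that] by (simp add: lin)
  have Ith2: "I (D (i (i th))) = 2 * I (D (i a))"
    using arg_cong[OF th2(1), of I] by (simp add: lin)
  have IR1: "I R1 = I (D' w) - I (D' a) + I (D' (i th)) + I (D (i w))"
    unfolding R1 by (simp add: lin)
  have IR2: "I R2 = I (D w) - I (D a) + I (D (i th)) + I (D' th)"
    unfolding R2 by (simp add: lin)
  have IIR2: "I (I R2) = I (I (D w)) - I (I (D a)) + I (I (D (i th))) + I (I (D' th))"
    unfolding IR2 by (simp add: lin)
  \<comment> \<open>The right side combines instances of \<open>D'h\<close> and \<open>Dh\<close> at
    \<open>w\<close>, \<open>a\<close>, \<open>th\<close> and \<open>i th\<close>, some of them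
    contracted once more by \<open>I\<close>, so each bracket vanishes. A literal 0 stands for one
    of the second-order terms that vanish by assumption.\<close>
  have "6 * D' (i w) - (6 * I R1 - 3 * I (I R2) + I (I (I (D th)))) =
      6 * (D' (i w) - (I (D' w) + h w))
    + 3 * (0 + I (I (D w)) + 2 * h w - 2 * I (D (i w)))
    - 6 * (D' (i a) - (I (D' a) + h a))
    - 3 * (0 + I (I (D a)) + 2 * h a - 2 * I (D (i a)))
    + 3 * (2 * D' (i a) - (I (D' (i th)) + h (i th)))
    - 3 * (I (D' (i th)) - (I (I (D' th)) + h (i th)))
    + (0 + I (I (D (i th))) + 2 * h (i th) - 2 * (2 * I (D (i a))))
    - (2 * I (D (i a)) + I (I (I (D th))) + 2 * h (i th) - 2 * I (I (D (i th))))"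
    unfolding IR1 IIR2 by (simp add: algebra_simps)
  also have "\<dots> = 0"
    using D'h[of w] D'h[of a] D'h[of "i th"] ID'h[of th] Dh[of w, unfolded w] Dh[of a, unfolded a]
      Dh[of "i th", unfolded th Ith2] IDh[of th, unfolded Ith2] good
    by (simp only: th2 diff_self mult_zero_right add_0 diff_zero)
  finally show "6 * D' (i w) = 6 * I R1 - 3 * I (I R2) + I (I (I (D th)))"
    by simp
  \<comment> \<open>Here two relations suffice: \<open>Dh\<close> and \<open>D'h\<close> at
    \<open>th\<close>.\<close>
  have "2 * (D (i w) - D (i a) - I (D w - D a) + (D' w - D' a)) -
        (2 * R1 - 2 * I R2 + I (I (D th))) =
      - (2 * D (i a) + I (I (D th)) + 2 * h th - 2 * I (D (i th)))
      - 2 * (D' (i th) - (I (D' th) + h th))"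
    unfolding R1 IR2 minus by (simp add: algebra_simps)
  also have "\<dots> = 0"
    using D'h[of th] Dh[of th, unfolded th2] good
    by (simp only: diff_self mult_zero_right minus_zero)
  finally show "2 * (D (i w) - D (i a) - I (D w - D a) + (D' w - D' a)) =
         2 * R1 - 2 * I R2 + I (I (D th))"
    by simp
qed

text \<open>\<open>X - Y\<close> is symmetric, so its pairing \<open>s\<close> with the
  antisymmetric \<open>E\<close> satisfies \<open>s = - s\<close>, and 2 is not a zero divisor. This
  is needed because integrability prescribes the conjugate derivatives of \<phi> only up to a part
  symmetric in the two form indices.\<close>

lemma symmetric_sum_antisymmetric:
  fixes X Y E :: "'i::finite \<Rightarrow> 'i \<Rightarrow> 'r::{idom,semiring_char_0}"
  assumes XY: "\<And>l m. X l m - X m l = Y l m - Y m l"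
    and E: "\<And>l m. E l m = - E m l"
  shows "(\<Sum>l\<in>UNIV. \<Sum>m\<in>UNIV. X l m * E l m) = (\<Sum>l\<in>UNIV. \<Sum>m\<in>UNIV. Y l m * E l m)"
proof -
  define Z where "Z l m = X l m - Y l m" for l m
  define s where "s = (\<Sum>l\<in>UNIV. \<Sum>m\<in>UNIV. Z l m * E l m)"
  have Z: "Z l m = Z m l" for l m
    using XY[of l m] by (simp add: Z_def algebra_simps)
  have "s = (\<Sum>l\<in>UNIV. \<Sum>m\<in>UNIV. Z m l * E m l)"
    unfolding s_def by (rule sum.swap)
  also have "\<dots> = (\<Sum>l\<in>UNIV. \<Sum>m\<in>UNIV. - (Z l m * E l m))"
  proof (intro sum.cong refl)
    fix l m
    show "Z m l * E m l = - (Z l m * E l m)"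
      using Z[of m l] E[of m l] by simp
  qed
  also have "\<dots> = - s"
    by (simp add: s_def sum_negf)
  finally have "2 * s = 0"
    by (metis add.left_inverse mult_2)
  then have "s = 0" by simp
  then show ?thesis
    by (simp add: s_def Z_def left_diff_distrib sum_subtractf)
qed

section \<open>First-order calculus with formal one-jets\<close>

definition unit_covec :: "'i \<Rightarrow> 'i \<Rightarrow> 'r::comm_ring_1" where
  "unit_covec s k = (if k = s then 1 else 0)"

lemma rwedge_expand:
  fixes \<alpha> :: "'i::finite \<Rightarrow> 'r::comm_ring_1"
  shows "rwedge \<alpha> u L = (\<Sum>m\<in>UNIV. \<alpha> m * rwedge (unit_covec m) u L)"
proof -
  have "\<alpha> = (\<lambda>k. \<Sum>m\<in>UNIV. \<alpha> m * unit_covec m k)"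
    by (simp add: unit_covec_def if_distrib[of "\<lambda>x. _ * x"] cong: if_cong)
  then have "rwedge \<alpha> u L = rwedge (\<lambda>k. \<Sum>m\<in>UNIV. \<alpha> m * unit_covec m k) u L"
    by simp
  then show ?thesis
    by (simp only: rwedge_sum_left rwedge_mult_left)
qed

lemma sum_unit_covec: "(\<Sum>j\<in>UNIV. P j k * unit_covec s j) = P (s::'i::finite) k"
  by (simp add: unit_covec_def if_distrib[of "\<lambda>x. _ * x"] cong: if_cong)

text \<open>With \<open>w\<close> the gradient of a form, the index sets \<open>range Inl\<close>
  and \<open>range Inr\<close> give \<partial> and its conjugate.\<close>

definition dsum :: "'i set \<Rightarrow> ('i \<Rightarrow> 'i list \<Rightarrow> 'r::comm_ring_1) \<Rightarrow> 'i list \<Rightarrow> 'r" where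
  "dsum T w L = (\<Sum>s\<in>T. rwedge (unit_covec s) (w s) L)"

text \<open>The product rule: if \<open>Pd\<close> and \<open>w\<close> are the derivatives of
  \<open>P\<close> and \<open>u\<close>, this is the derivative of the contraction in direction
  \<open>s\<close>.\<close>

definition ract_grad :: "('i::finite \<Rightarrow> 'i \<Rightarrow> 'r::comm_ring_1) \<Rightarrow> ('i \<Rightarrow> 'i \<Rightarrow> 'i \<Rightarrow> 'r) \<Rightarrow>
    ('i list \<Rightarrow> 'r) \<Rightarrow> ('i \<Rightarrow> 'i list \<Rightarrow> 'r) \<Rightarrow> 'i \<Rightarrow> 'i list \<Rightarrow> 'r" where
  "ract_grad P Pd u w s L = ract (Pd s) u L + ract P (w s) L"

text \<open>On alternating \<open>u\<close> this is the action of half the bracket of the Beltrami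
  differential with itself. It plays the part of \<open>H\<close> in the identities above.\<close>

definition rhor :: "'i set \<Rightarrow> ('i::finite \<Rightarrow> 'i \<Rightarrow> 'r::comm_ring_1) \<Rightarrow> ('i \<Rightarrow> 'i \<Rightarrow> 'i \<Rightarrow> 'r) \<Rightarrow>
    ('i list \<Rightarrow> 'r) \<Rightarrow> 'i list \<Rightarrow> 'r" where
  "rhor S P Pd u L = (\<Sum>s\<in>S. rwedge (P s) (ract (Pd s) u) L)"

text \<open>Moving the contraction past the unit covector of index \<open>s\<close> turns that
  covector into \<open>P s\<close>, which gives the subtracted sum; the added one comes from
  differentiating the coefficients of the contraction.\<close>

lemma dsum_ract_grad:
  "dsum T (ract_grad P Pd u w) L = ract P (dsum T w) L +
     (\<Sum>s\<in>T. rwedge (unit_covec s) (ract (Pd s) u) L) - (\<Sum>s\<in>T. rwedge (P s) (w s) L)"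
  unfolding dsum_def ract_grad_def
  by (simp add: ract_sum ract_rwedge rwedge_add sum.distrib sum_unit_covec)

text \<open>The value \<open>P\<close> and the first derivatives \<open>Pd\<close> of a Beltrami
  differential at one point, constrained by type alone. The choice \<open>S = range Inr\<close>
  covers the conjugate differential.\<close>

locale jet_type =
  fixes S :: "'i::finite set" and P :: "'i \<Rightarrow> 'i \<Rightarrow> 'r::{idom,semiring_char_0}"
    and Pd :: "'i \<Rightarrow> 'i \<Rightarrow> 'i \<Rightarrow> 'r"
  assumes P_type: "P j k \<noteq> 0 \<Longrightarrow> j \<in> S \<and> k \<notin> S"
    and Pd_type: "Pd s j k \<noteq> 0 \<Longrightarrow> j \<in> S \<and> k \<notin> S"
begin

text \<open>In each matrix product the middle index would have to lie both in \<open>S\<close> and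
  outside it, so the commutator matrix is zero.\<close>

lemma ract_P_commute: "ract P (ract (Pd s) u) = ract (Pd s) (ract P u)"
proof
  fix L
  have "P l k * Pd s j l = 0" "Pd s l k * P j l = 0" for l k j
    using P_type Pd_type by (metis mult_eq_0_iff)+
  then have "ract P (ract (Pd s) u) L - ract (Pd s) (ract P u) L = 0"
    unfolding ract_commutator by (simp add: ract_zero_left del: mult_eq_0_iff)
  then show "ract P (ract (Pd s) u) L = ract (Pd s) (ract P u) L" by simp
qed

lemma P_nilpotent: "(\<Sum>j\<in>UNIV. P j k * P s j) = 0"
  using P_type by (intro sum.neutral) (metis mult_eq_0_iff)

lemma ract_rwedge_P: "ract P (rwedge (P s) u) L = rwedge (P s) (ract P u) L"
  unfolding ract_rwedge by (simp add: P_nilpotent rwedge_zero_left)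

lemma rhor_ract: "rhor S P Pd (ract P u) L = ract P (rhor S P Pd u) L"
  unfolding rhor_def by (simp add: ract_sum ract_rwedge_P flip: ract_P_commute)

text \<open>This is \<open>[[D, i], i] = -2 H\<close>. In \<open>D i = i D + K - F\<close> the
  operator \<open>K\<close> differentiates the coefficients of the contraction and \<open>F\<close>
  the form; commuting \<open>i\<close> past each of them leaves one copy of \<open>rhor\<close>,
  whence the factor 2.\<close>

lemma del_ract_ract:
  "dsum S (ract_grad P Pd (ract P u) (ract_grad P Pd u w)) L + ract P (ract P (dsum S w)) L +
     2 * rhor S P Pd u L = 2 * ract P (dsum S (ract_grad P Pd u w)) L"
proof -
  define K where "K u L = (\<Sum>s\<in>S. rwedge (unit_covec s) (ract (Pd s) u) L)" for u L
  define F where "F w L = (\<Sum>s\<in>S. rwedge (P s) (w s) L)" for w L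
  have D: "dsum S (ract_grad P Pd u w) L = ract P (dsum S w) L + K u L - F w L" for u w L
    unfolding dsum_ract_grad K_def F_def ..
  have F: "F (ract_grad P Pd u w) L = rhor S P Pd u L + ract P (F w) L"
    unfolding F_def rhor_def ract_grad_def
    by (simp add: rwedge_add sum.distrib ract_sum ract_rwedge_P)
  have K: "ract P (K u) L = rhor S P Pd u L + K (ract P u) L"
    unfolding K_def rhor_def
    by (simp add: ract_sum ract_rwedge sum_unit_covec sum.distrib ract_P_commute)
  have D': "ract P (dsum S (ract_grad P Pd u w)) L =
      ract P (ract P (dsum S w)) L + ract P (K u) L - ract P (F w) L"
    unfolding D ract_diff ract_add ..
  show ?thesis
    unfolding D[of "ract P u"] D' F K by (simp add: algebra_simps)
qed

text \<open>In directions outside \<open>S\<close> the sum with \<open>P s\<close> disappears. What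
  is left is the conjugate derivative of \<phi>, which integrability turns into \<open>rhor\<close>.
  Alternation allows writing the contraction with interior products, so that only the part
  antisymmetric in the two form indices enters.\<close>

lemma delbar_ract:
  assumes "ralt u"
    and int: "\<And>j l m. l \<notin> S \<Longrightarrow> m \<notin> S \<Longrightarrow>
      Pd l j m - Pd m j l = (\<Sum>s\<in>S. P s l * Pd s j m - P s m * Pd s j l)"
  shows "dsum (- S) (ract_grad P Pd u w) L = ract P (dsum (- S) w) L + rhor S P Pd u L"
proof -
  define E where "E j l m = rwedge (unit_covec l) (rwedge (unit_covec m) (\<lambda>L. u (j # L))) L"
    for j l m
  \<comment> \<open>Extension by zero lets \<open>l\<close> run over all indices; \<open>X\<close>
    and \<open>Y\<close> are the two sides of the integrability condition before
    antisymmetrization.\<close>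
  define X where "X j l m = (if l \<in> S then 0 else Pd l j m)" for j l m
  define Y where "Y j l m = (\<Sum>s\<in>S. P s l * Pd s j m)" for j l m
  have wedge2: "rwedge \<alpha> (ract (Pd s) u) L =
      (\<Sum>j\<in>UNIV. \<Sum>l\<in>UNIV. \<Sum>m\<in>UNIV. \<alpha> l * Pd s j m * E j l m)" for \<alpha> s
  proof -
    have "rwedge \<alpha> (ract (Pd s) u) L =
        (\<Sum>j\<in>UNIV. rwedge \<alpha> (rwedge (Pd s j) (\<lambda>L. u (j # L))) L)"
      unfolding ract_eq_rwedge[OF assms(1), abs_def] rwedge_sum ..
    also have "\<dots> = (\<Sum>j\<in>UNIV. \<Sum>l\<in>UNIV. \<alpha> l *
        rwedge (unit_covec l) (rwedge (Pd s j) (\<lambda>L. u (j # L))) L)"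
      by (subst rwedge_expand) (rule refl)
    also have "\<dots> = (\<Sum>j\<in>UNIV. \<Sum>l\<in>UNIV. \<Sum>m\<in>UNIV. \<alpha> l * Pd s j m * E j l m)"
      unfolding E_def rwedge_expand[of "Pd s _", abs_def] rwedge_sum rwedge_mult sum_distrib_left
      by (simp add: mult.assoc)
    finally show ?thesis .
  qed
  have P0: "P s = (\<lambda>k. 0)" if "s \<notin> S" for s
    using P_type that by blast
  have Pd0: "Pd s j m = 0" if "m \<in> S" for s j m
    using Pd_type that by blast
  have P0': "P s l = 0" if "l \<in> S" for s l
    using P_type that by blast
  have "rwedge (unit_covec s) (ract (Pd s) u) L = (\<Sum>j\<in>UNIV. \<Sum>m\<in>UNIV. Pd s j m * E j s m)" for s
  proof -
    have "(\<Sum>l\<in>UNIV. \<Sum>m\<in>UNIV. unit_covec s l * Pd s j m * E j l m) =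
        (\<Sum>l\<in>UNIV. if l = s then \<Sum>m\<in>UNIV. Pd s j m * E j l m else 0)" for j
      by (intro sum.cong refl) (simp add: unit_covec_def)
    then show ?thesis
      unfolding wedge2 by simp
  qed
  then have "(\<Sum>s\<in>-S. rwedge (unit_covec s) (ract (Pd s) u) L) =
      (\<Sum>s\<in>-S. \<Sum>j\<in>UNIV. \<Sum>m\<in>UNIV. Pd s j m * E j s m)"
    by simp
  also have "\<dots> = (\<Sum>j\<in>UNIV. \<Sum>l\<in>UNIV. \<Sum>m\<in>UNIV. X j l m * E j l m)"
  proof -
    have "(\<Sum>l\<in>-S. \<Sum>m\<in>UNIV. Pd l j m * E j l m) =
        (\<Sum>l\<in>-S. \<Sum>m\<in>UNIV. X j l m * E j l m)" for j
      by (intro sum.cong refl) (simp add: X_def)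
    moreover have "(\<Sum>l\<in>-S. \<Sum>m\<in>UNIV. X j l m * E j l m) =
        (\<Sum>l\<in>UNIV. \<Sum>m\<in>UNIV. X j l m * E j l m)" for j
      by (intro sum.mono_neutral_left) (auto simp: X_def)
    ultimately show ?thesis
      by (simp only: sum.swap[of _ UNIV "- S"])
  qed
  also have "\<dots> = (\<Sum>j\<in>UNIV. \<Sum>l\<in>UNIV. \<Sum>m\<in>UNIV. Y j l m * E j l m)"
  proof (rule sum.cong[OF refl], rule symmetric_sum_antisymmetric)
    fix j l m
    show "X j l m - X j m l = Y j l m - Y j m l"
      using int[of l m j] by (auto simp: X_def Y_def Pd0 P0' sum_subtractf)
    show "E j l m = - E j m l"
      unfolding E_def by (rule rwedge_anticommute)
  qed
  also have "\<dots> = rhor S P Pd u L"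
  proof -
    have "(\<Sum>m\<in>UNIV. Y j l m * E j l m) =
        (\<Sum>s\<in>S. \<Sum>m\<in>UNIV. P s l * Pd s j m * E j l m)" for j l
      unfolding Y_def sum_distrib_right by (rule sum.swap)
    then have "(\<Sum>l\<in>UNIV. \<Sum>m\<in>UNIV. Y j l m * E j l m) =
        (\<Sum>s\<in>S. \<Sum>l\<in>UNIV. \<Sum>m\<in>UNIV. P s l * Pd s j m * E j l m)" for j
      by (simp only: sum.swap[of _ S])
    then show ?thesis
      unfolding rhor_def wedge2 by (simp only: sum.swap[of _ S])
  qed
  finally show ?thesis
    unfolding dsum_ract_grad by (simp add: P0 rwedge_zero_left)
qed

end

section \<open>Values and gradients of series of forms\<close>

unbundle no vec_syntax

section \<open>Rules for Wirtinger derivatives\<close>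

definition wirt_of :: "'n::finite + 'n \<Rightarrow> (complex^'n \<Rightarrow> complex) \<Rightarrow> complex" where
  "wirt_of i D = (case i of
       Inl s \<Rightarrow> (D (axis s 1) - \<i> * D (axis s \<i>)) / 2
     | Inr s \<Rightarrow> (D (axis s 1) + \<i> * D (axis s \<i>)) / 2)"

lemma wirtinger_eq_wirt_of: "wirtinger i f x = wirt_of i (frechet_derivative f (at x))"
  by (simp add: wirtinger_def wirt_of_def Let_def)

text \<open>A relational form of all Wirtinger derivatives at once that includes differentiability,
  so that the rules for sums, products and conjugates compose.\<close>

definition has_wirt :: "(complex^'n::finite \<Rightarrow> complex) \<Rightarrow> ('n + 'n \<Rightarrow> complex) \<Rightarrow> complex^'n \<Rightarrow> bool" where
  "has_wirt f W x \<longleftrightarrow> (\<exists>D. (f has_derivative D) (at x) \<and> (\<forall>i. W i = wirt_of i D))"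

lemma has_wirt_wirtinger: "f differentiable (at x) \<Longrightarrow> has_wirt f (\<lambda>i. wirtinger i f x) x"
  unfolding has_wirt_def wirtinger_eq_wirt_of using frechet_derivative_works by blast

lemma has_wirt_imp_wirtinger: "has_wirt f W x \<Longrightarrow> wirtinger i f x = W i"
  unfolding has_wirt_def wirtinger_eq_wirt_of using frechet_derivative_at by metis

lemma has_wirt_imp_differentiable: "has_wirt f W x \<Longrightarrow> f differentiable (at x)"
  unfolding has_wirt_def differentiable_def by blast

lemma has_wirt_const: "has_wirt (\<lambda>y. c) (\<lambda>i. 0) x"
  unfolding has_wirt_def by (intro exI[of _ "\<lambda>v. 0"]) (auto simp: wirt_of_def split: sum.split)

lemma has_wirt_add:
  assumes "has_wirt f F x" "has_wirt g G x"
  shows "has_wirt (\<lambda>y. f y + g y) (\<lambda>i. F i + G i) x"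
proof -
  obtain D E where D: "(f has_derivative D) (at x)" "\<And>i. F i = wirt_of i D"
    and E: "(g has_derivative E) (at x)" "\<And>i. G i = wirt_of i E"
    using assms unfolding has_wirt_def by blast
  show ?thesis
    unfolding has_wirt_def D E
    by (intro exI[of _ "\<lambda>v. D v + E v"] conjI has_derivative_add D E)
      (auto simp: wirt_of_def field_simps split: sum.split)
qed

lemma has_wirt_mult:
  assumes "has_wirt f F x" "has_wirt g G x"
  shows "has_wirt (\<lambda>y. f y * g y) (\<lambda>i. F i * g x + f x * G i) x"
proof -
  obtain D E where D: "(f has_derivative D) (at x)" "\<And>i. F i = wirt_of i D"
    and E: "(g has_derivative E) (at x)" "\<And>i. G i = wirt_of i E"
    using assms unfolding has_wirt_def by blast
  show ?thesis
    unfolding has_wirt_def D E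
    by (intro exI[of _ "\<lambda>v. f x * E v + D v * g x"] conjI has_derivative_mult D E)
      (auto simp: wirt_of_def field_simps split: sum.split)
qed

lemma has_wirt_cnj:
  assumes "has_wirt f F x"
  shows "has_wirt (\<lambda>y. cnj (f y)) (\<lambda>i. cnj (F (bar i))) x"
proof -
  obtain D where D: "(f has_derivative D) (at x)" "\<And>i. F i = wirt_of i D"
    using assms unfolding has_wirt_def by blast
  show ?thesis
    unfolding has_wirt_def D
    by (intro exI[of _ "\<lambda>v. cnj (D v)"] conjI has_derivative_cnj D)
      (auto simp: wirt_of_def bar_def split: sum.split)
qed

lemma has_wirt_diff:
  assumes "has_wirt f F x" "has_wirt g G x"
  shows "has_wirt (\<lambda>y. f y - g y) (\<lambda>i. F i - G i) x"
  using has_wirt_add[OF assms(1) has_wirt_mult[OF has_wirt_const[of "-1"] assms(2)]] by simp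

lemma has_wirt_sum:
  assumes "\<And>a. a \<in> A \<Longrightarrow> has_wirt (f a) (F a) x"
  shows "has_wirt (\<lambda>y. \<Sum>a\<in>A. f a y) (\<lambda>i. \<Sum>a\<in>A. F a i) x"
  using assms
  by (induction A rule: infinite_finite_induct) (auto intro: has_wirt_const has_wirt_add)

lemma has_wirt_ract:
  assumes "\<And>j k. has_wirt (\<lambda>y. M y j k) (\<lambda>i. M' i j k) x"
    and "\<And>L. has_wirt (\<lambda>y. u y L) (\<lambda>i. u' i L) x"
  shows "has_wirt (\<lambda>y. ract (M y) (u y) L) (\<lambda>i. ract (M' i) (u x) L + ract (M x) (u' i) L) x"
  using assms(2)
proof (induction L arbitrary: u u')
  case Nil
  then show ?case by (simp add: has_wirt_const)
next
  case (Cons k L)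
  have "has_wirt (\<lambda>y. (\<Sum>j\<in>UNIV. M y j k * u y (j # L)) + ract (M y) (\<lambda>L. u y (k # L)) L)
     (\<lambda>i. (\<Sum>j\<in>UNIV. M' i j k * u x (j # L) + M x j k * u' i (j # L)) +
       (ract (M' i) (\<lambda>L. u x (k # L)) L + ract (M x) (\<lambda>L. u' i (k # L)) L)) x"
    by (intro has_wirt_add has_wirt_sum has_wirt_mult assms(1) Cons)
  then show ?case
    by (simp add: sum.distrib algebra_simps)
qed

lemma wirtinger_cong_open:
  assumes "open U" "x \<in> U" "\<And>y. y \<in> U \<Longrightarrow> f y = g y"
  shows "wirtinger i f x = wirtinger i g x"
proof -
  have "(f has_derivative D) (at x) \<longleftrightarrow> (g has_derivative D) (at x)" for D
    using has_derivative_transform_within_open[OF _ assms(1,2)] assms(3) by metis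
  then show ?thesis
    unfolding wirtinger_eq_wirt_of frechet_derivative_def by simp
qed

section \<open>Form series as functions into double power series\<close>

lemma sum_fun_apply: "(\<Sum>a\<in>A. f a) x = (\<Sum>a\<in>A. f a x)"
  by (induction A rule: infinite_finite_induct) simp_all

text \<open>The outer variable is \<open>t\<close> and the inner one its conjugate. The type
  \<open>complex fps fps\<close> is an integral domain of characteristic zero, as the algebra above
  demands.\<close>

definition fser :: "complex series \<Rightarrow> complex fps fps" where
  "fser \<alpha> = Abs_fps (\<lambda>i. Abs_fps (\<lambda>j. \<alpha> i j))"

lemma fser_nth [simp]: "fser \<alpha> $ i $ j = \<alpha> i j"
  by (simp add: fser_def)

lemma fps2_eqI: "(\<And>i j. f $ i $ j = g $ i $ j) \<Longrightarrow> f = g"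
  by (intro fps_ext)

lemma fps2_mult_nth:
  "(f * g) $ i $ j = (\<Sum>a\<le>i. \<Sum>b\<le>j. f $ a $ b * g $ (i - a) $ (j - b))"
  by (simp add: fps_mult_nth fps_sum_nth atLeast0AtMost)

lemma ract_nth:
  fixes M :: "'i::finite \<Rightarrow> 'i \<Rightarrow> complex fps fps"
  shows "ract M u L $ i $ j = (\<Sum>a\<le>i. \<Sum>b\<le>j.
    ract (\<lambda>p q. M p q $ a $ b) (\<lambda>L. u L $ (i - a) $ (j - b)) L)"
proof (induction L arbitrary: u)
  case (Cons k L)
  have "(\<Sum>p\<in>UNIV. M p k * u (p # L)) $ i $ j =
      (\<Sum>p\<in>UNIV. \<Sum>a\<le>i. \<Sum>b\<le>j. M p k $ a $ b * u (p # L) $ (i - a) $ (j - b))"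
    by (simp add: fps_sum_nth fps2_mult_nth)
  also have "\<dots> = (\<Sum>a\<le>i. \<Sum>p\<in>UNIV. \<Sum>b\<le>j. M p k $ a $ b * u (p # L) $ (i - a) $ (j - b))"
    by (rule sum.swap)
  also have "\<dots> = (\<Sum>a\<le>i. \<Sum>b\<le>j. \<Sum>p\<in>UNIV. M p k $ a $ b * u (p # L) $ (i - a) $ (j - b))"
    by (intro sum.cong refl sum.swap)
  finally show ?case
    by (simp add: Cons.IH sum.distrib)
qed simp

text \<open>\<open>val\<close> and \<open>grad\<close>, together with \<open>vmat\<close> and
  \<open>vgrad\<close> for vector-valued series, form the one-jets at \<open>x\<close> to which the
  pointwise relations apply.\<close>

definition val :: "('a, 'n::finite) chart \<Rightarrow> complex^'n \<Rightarrow> ('a, 'n) form series \<Rightarrow>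
    ('n + 'n) list \<Rightarrow> complex fps fps" where
  "val c x v L = fser (\<lambda>i j. v i j c x L)"

definition grad :: "('a, 'n::finite) chart \<Rightarrow> complex^'n \<Rightarrow> ('a, 'n) form series \<Rightarrow>
    'n + 'n \<Rightarrow> ('n + 'n) list \<Rightarrow> complex fps fps" where
  "grad c x v s L = fser (\<lambda>i j. wirtinger s (\<lambda>y. v i j c y L) x)"

definition vmat :: "('a, 'n::finite) chart \<Rightarrow> complex^'n \<Rightarrow> ('a, 'n) vform series \<Rightarrow>
    'n + 'n \<Rightarrow> 'n + 'n \<Rightarrow> complex fps fps" where
  "vmat c x \<psi> j k = fser (\<lambda>a b. \<psi> a b c j x [k])"

definition vgrad :: "('a, 'n::finite) chart \<Rightarrow> complex^'n \<Rightarrow> ('a, 'n) vform series \<Rightarrow>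
    'n + 'n \<Rightarrow> 'n + 'n \<Rightarrow> 'n + 'n \<Rightarrow> complex fps fps" where
  "vgrad c x \<psi> s j k = fser (\<lambda>a b. wirtinger s (\<lambda>y. \<psi> a b c j y [k]) x)"

definition sdiff :: "('a, 'n::finite) chart \<Rightarrow> ('a, 'n) form series \<Rightarrow> bool" where
  "sdiff c v \<longleftrightarrow> (\<forall>i j L. \<forall>x\<in>chart_image c. (\<lambda>y. v i j c y L) differentiable (at x))"

definition vdiff :: "('a, 'n::finite) chart \<Rightarrow> ('a, 'n) vform series \<Rightarrow> bool" where
  "vdiff c \<psi> \<longleftrightarrow>
     (\<forall>a b j k. \<forall>x\<in>chart_image c. (\<lambda>y. \<psi> a b c j y [k]) differentiable (at x))"

lemma scontract_apply:
  "(\<psi> \<rightharpoondown> v) i j c y L = (\<Sum>a\<le>i. \<Sum>b\<le>j.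
     ract (\<lambda>p q. \<psi> a b c p y [q]) (v (i - a) (j - b) c y) L)"
  by (simp add: sprod_def sum_fun_apply contract_def contract_at_eq_ract)

lemma svcontract_apply:
  "(\<psi> \<rightharpoondown>\<^sub>v \<chi>) i j c p y [q] = (\<Sum>a\<le>i. \<Sum>b\<le>j. \<Sum>l\<in>UNIV.
     \<psi> a b c l y [q] * \<chi> (i - a) (j - b) c p y [l])"
  by (simp add: sprod_def sum_fun_apply vcontract_def contract_at_eq_ract)

lemma val_contract: "val c x (\<psi> \<rightharpoondown> v) = ract (vmat c x \<psi>) (val c x v)"
  by (intro ext fps2_eqI) (simp add: val_def ract_nth vmat_def scontract_apply)

lemma vmat_contract:
  "vmat c x (\<psi> \<rightharpoondown>\<^sub>v \<chi>) p q = (\<Sum>l\<in>UNIV. vmat c x \<psi> l q * vmat c x \<chi> p l)"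
proof (rule fps2_eqI)
  fix i j
  have "(\<Sum>a\<le>i. \<Sum>b\<le>j. \<Sum>l\<in>UNIV. \<psi> a b c l x [q] * \<chi> (i - a) (j - b) c p x [l]) =
      (\<Sum>l\<in>UNIV. \<Sum>a\<le>i. \<Sum>b\<le>j. \<psi> a b c l x [q] * \<chi> (i - a) (j - b) c p x [l])"
    by (simp only: sum.swap[of _ UNIV])
  then show "vmat c x (\<psi> \<rightharpoondown>\<^sub>v \<chi>) p q $ i $ j = (\<Sum>l\<in>UNIV. vmat c x \<psi> l q * vmat c x \<chi> p l) $ i $ j"
    unfolding vmat_def by (simp add: fps_sum_nth fps2_mult_nth svcontract_apply)
qed

lemma has_wirt_contract:
  assumes "vdiff c \<psi>" "sdiff c v" "x \<in> chart_image c"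
  shows "has_wirt (\<lambda>y. (\<psi> \<rightharpoondown> v) i j c y L) (\<lambda>s. \<Sum>a\<le>i. \<Sum>b\<le>j.
     ract (\<lambda>p q. wirtinger s (\<lambda>y. \<psi> a b c p y [q]) x) (v (i - a) (j - b) c x) L +
     ract (\<lambda>p q. \<psi> a b c p x [q]) (\<lambda>L. wirtinger s (\<lambda>y. v (i - a) (j - b) c y L) x) L) x"
  unfolding scontract_apply using assms
  by (intro has_wirt_sum has_wirt_ract has_wirt_wirtinger) (auto simp: vdiff_def sdiff_def)

lemma sdiff_contract: "vdiff c \<psi> \<Longrightarrow> sdiff c v \<Longrightarrow> sdiff c (\<psi> \<rightharpoondown> v)"
  unfolding sdiff_def[of c "\<psi> \<rightharpoondown> v"] by (blast intro: has_wirt_imp_differentiable has_wirt_contract)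

lemma vdiff_contract:
  assumes "vdiff c \<psi>" "vdiff c \<chi>"
  shows "vdiff c (\<psi> \<rightharpoondown>\<^sub>v \<chi>)"
proof -
  have "\<exists>W. has_wirt (\<lambda>y. (\<psi> \<rightharpoondown>\<^sub>v \<chi>) a b c j y [k]) W x" if "x \<in> chart_image c" for a b j k x
    unfolding svcontract_apply using assms that unfolding vdiff_def
    by - (rule exI, (rule has_wirt_sum has_wirt_mult has_wirt_wirtinger; simp)+)
  then show ?thesis
    unfolding vdiff_def by (blast intro: has_wirt_imp_differentiable)
qed

lemma grad_contract:
  assumes "vdiff c \<psi>" "sdiff c v" "x \<in> chart_image c"
  shows "grad c x (\<psi> \<rightharpoondown> v) =
    ract_grad (vmat c x \<psi>) (vgrad c x \<psi>) (val c x v) (grad c x v)"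
  by (intro ext fps2_eqI)
    (simp add: grad_def ract_grad_def ract_nth vmat_def vgrad_def val_def
      has_wirt_imp_wirtinger[OF has_wirt_contract[OF assms]] sum.distrib)

lemma rwedge_unit_nth:
  fixes u :: "_ \<Rightarrow> complex fps fps"
  shows "rwedge (unit_covec s) u L $ i $ j = rwedge (unit_covec s) (\<lambda>L. u L $ i $ j) L"
  by (induction L arbitrary: u) (simp_all add: unit_covec_def)

lemma rwedge_dw: "rwedge (\<lambda>k. dw s [k]) = rwedge (unit_covec s)"
  by (simp add: dw_def unit_covec_def[abs_def] eq_commute cong: if_cong)

lemma val_del: "val c x (sdel v) = dsum (range Inl) (grad c x v)"
proof (intro ext fps2_eqI)
  fix L i j
  show "val c x (sdel v) L $ i $ j = dsum (range Inl) (grad c x v) L $ i $ j"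
    by (simp add: val_def dsum_def smap_def del_def del_loc_def sum_fun_apply wedge1_eq_rwedge
        fps_sum_nth rwedge_unit_nth grad_def pd_covec_def[abs_def] rwedge_dw sum.reindex)
qed

lemma val_delbar: "val c x (sdelbar v) = dsum (range Inr) (grad c x v)"
proof (intro ext fps2_eqI)
  fix L i j
  show "val c x (sdelbar v) L $ i $ j = dsum (range Inr) (grad c x v) L $ i $ j"
    by (simp add: val_def dsum_def smap_def delbar_def delbar_loc_def sum_fun_apply wedge1_eq_rwedge
        fps_sum_nth rwedge_unit_nth grad_def pd_covec_def[abs_def] rwedge_dw sum.reindex)
qed

text \<open>Derivatives at \<open>x\<close> depend on nearby values, so an algebraic identity has to
  hold on the whole chart image before it can be differentiated.\<close>

lemma grad_cong:
  assumes "open (chart_image c)" "x \<in> chart_image c"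
    and "\<And>y. y \<in> chart_image c \<Longrightarrow> val c y v = val c y w"
  shows "grad c x v = grad c x w"
proof -
  have "v i j c y L = w i j c y L" if "y \<in> chart_image c" for i j y L
    using assms(3)[OF that] unfolding val_def by (metis fser_nth)
  then show ?thesis
    unfolding grad_def
    by (intro ext arg_cong[of _ _ fser] wirtinger_cong_open[OF assms(1,2)])
qed

lemma val_diff: "val c x (v - w) = val c x v - val c x w"
  by (intro ext fps2_eqI) (simp add: val_def)

lemma val_add: "val c x (v + w) = val c x v + val c x w"
  by (intro ext fps2_eqI) (simp add: val_def)

lemma grad_diff:
  assumes "sdiff c v" "sdiff c w" "x \<in> chart_image c"
  shows "grad c x (v - w) = grad c x v - grad c x w"
  using assms
  by (intro ext fps2_eqI)
    (auto simp: grad_def sdiff_def intro!: has_wirt_imp_wirtinger has_wirt_diff has_wirt_wirtinger)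

lemma grad_add:
  assumes "sdiff c v" "sdiff c w" "x \<in> chart_image c"
  shows "grad c x (v + w) = grad c x v + grad c x w"
  using assms
  by (intro ext fps2_eqI)
    (auto simp: grad_def sdiff_def intro!: has_wirt_imp_wirtinger has_wirt_add has_wirt_wirtinger)

lemma grad_zero: "grad c x 0 = 0"
  by (intro ext fps2_eqI) (simp add: grad_def has_wirt_imp_wirtinger[OF has_wirt_const])

lemma dsum_diff: "dsum T (v - w) = dsum T v - dsum T w"
  by (intro ext) (simp add: dsum_def fun_diff_def rwedge_diff sum_subtractf)

lemma dsum_add: "dsum T (v + w) = dsum T v + dsum T w"
  by (intro ext) (simp add: dsum_def plus_fun_def rwedge_add sum.distrib)

lemma dsum_zero: "dsum T 0 = 0"
  by (intro ext) (simp add: dsum_def zero_fun_def rwedge_zero)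

section \<open>The extension equations in a chart\<close>

lemma plus_fun_apply: "(f + g) x = f x + g x"
  by (simp add: plus_fun_def)

lemma times_fun_apply: "(f * g) x = f x * g x"
  by (simp add: times_fun_def)

lemma numeral_fun_apply: "(numeral k :: 'a \<Rightarrow> 'b::comm_ring_1) x = numeral k"
  by (induction k) (simp_all only: numeral.simps one_fun_def plus_fun_apply)

lemma ract_fun_add: "ract M (u + v) = ract M u + ract M v"
  by (intro ext) (simp add: plus_fun_def ract_add)

lemma ract_fun_diff: "ract M (u - v) = ract M u - ract M v"
  by (intro ext) (simp add: fun_diff_def ract_diff)

lemma ract_fun_zero: "ract M 0 = 0"
  by (intro ext) (simp add: zero_fun_def ract_zero)

text \<open>The data \<open>range Inl\<close>, \<phi> and its conjugate lead to the two identities;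
  \<open>range Inr\<close> with \<phi> and its conjugate exchanged leads to their conjugates. A
  (1,1)-form has degree 1 in either index set.\<close>

locale extension_chart =
  fixes c :: "('a, 'n::finite) chart" and S :: "('n + 'n) set"
    and \<psi> \<chi> :: "('a, 'n) vform series" and \<omega> :: "('a, 'n) form series"
  assumes open_chart: "open (chart_image c)"
    and psi_type: "x \<in> chart_image c \<Longrightarrow> vmat c x \<psi> j k \<noteq> 0 \<Longrightarrow> j \<in> S \<and> k \<notin> S"
    and chi_type: "x \<in> chart_image c \<Longrightarrow> vmat c x \<chi> j k \<noteq> 0 \<Longrightarrow> j \<notin> S \<and> k \<in> S"
    and psi_diff: "vdiff c \<psi>" and chi_diff: "vdiff c \<chi>" and omega_diff: "sdiff c \<omega>"
    and omega_alt: "x \<in> chart_image c \<Longrightarrow> ralt (val c x \<omega>)"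
    and omega_supp: "x \<in> chart_image c \<Longrightarrow> rsupp S 1 (val c x \<omega>)"
    and psi_integrable: "x \<in> chart_image c \<Longrightarrow> l \<notin> S \<Longrightarrow> m \<notin> S \<Longrightarrow>
      vgrad c x \<psi> l j m - vgrad c x \<psi> m j l =
      (\<Sum>s\<in>S. vmat c x \<psi> s l * vgrad c x \<psi> s j m - vmat c x \<psi> s m * vgrad c x \<psi> s j l)"
begin

abbreviation (input) "A\<omega> \<equiv> (\<psi> \<rightharpoondown>\<^sub>v \<chi>) \<rightharpoondown> \<omega>"
abbreviation (input) "B\<omega> \<equiv> (\<chi> \<rightharpoondown>\<^sub>v \<psi>) \<rightharpoondown> \<omega>"

text \<open>The forbidden entries vanish identically on the open chart image, hence so do their
  derivatives.\<close>

lemma vgrad_type: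
  assumes "x \<in> chart_image c" "vgrad c x \<psi> s j k \<noteq> 0"
  shows "j \<in> S \<and> k \<notin> S"
proof (rule ccontr)
  assume *: "\<not> (j \<in> S \<and> k \<notin> S)"
  have "\<psi> a b c j y [k] = 0" if "y \<in> chart_image c" for a b y
  proof -
    have "vmat c y \<psi> j k = 0"
      using psi_type[OF that] * by blast
    then have "vmat c y \<psi> j k $ a $ b = 0" by simp
    then show ?thesis by (simp add: vmat_def)
  qed
  then have "wirtinger s (\<lambda>y. \<psi> a b c j y [k]) x = wirtinger s (\<lambda>y. 0) x" for a b
    by (intro wirtinger_cong_open[OF open_chart assms(1)]) auto
  then have "vgrad c x \<psi> s j k = 0"
    by (intro fps2_eqI) (simp add: vgrad_def has_wirt_imp_wirtinger[OF has_wirt_const])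
  with assms show False by simp
qed

lemma jet_type: "x \<in> chart_image c \<Longrightarrow> jet_type S (vmat c x \<psi>) (vgrad c x \<psi>)"
  using psi_type vgrad_type by unfold_locales auto

lemma A_type: "x \<in> chart_image c \<Longrightarrow> vmat c x (\<psi> \<rightharpoondown>\<^sub>v \<chi>) j k \<noteq> 0 \<Longrightarrow> j \<notin> S \<and> k \<notin> S"
  unfolding vmat_contract using psi_type chi_type
  by (metis (no_types, lifting) mult_eq_0_iff sum.neutral)

lemma B_type: "x \<in> chart_image c \<Longrightarrow> vmat c x (\<chi> \<rightharpoondown>\<^sub>v \<psi>) j k \<noteq> 0 \<Longrightarrow> j \<in> S \<and> k \<in> S"
  unfolding vmat_contract using psi_type chi_type
  by (metis (no_types, lifting) mult_eq_0_iff sum.neutral)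

text \<open>The first contraction uses up the only index of \<open>S\<close>, and the second finds
  none.\<close>

lemma psi_psi_zero:
  assumes "x \<in> chart_image c" "rsupp S 1 (val c x v)"
  shows "val c x (\<psi> \<rightharpoondown> \<psi> \<rightharpoondown> v) = 0"
proof -
  have "rsupp S 0 (ract (vmat c x \<psi>) (val c x v))"
    using assms psi_type by (intro rsupp_ract_lower) auto
  then show ?thesis
    unfolding val_contract using psi_type[OF assms(1)]
    by (intro ext) (simp add: ract_rsupp_0)
qed

lemma A_supp: "x \<in> chart_image c \<Longrightarrow> rsupp S 1 (val c x A\<omega>)"
  unfolding val_contract using A_type by (intro rsupp_ract_same omega_supp) auto

lemma commutator_psi_chi:
  assumes "x \<in> chart_image c"
  shows "val c x (\<psi> \<rightharpoondown> \<chi> \<rightharpoondown> v) - val c x (\<chi> \<rightharpoondown> \<psi> \<rightharpoondown> v) =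
    val c x ((\<psi> \<rightharpoondown>\<^sub>v \<chi>) \<rightharpoondown> v) - val c x ((\<chi> \<rightharpoondown>\<^sub>v \<psi>) \<rightharpoondown> v)"
proof
  fix L
  show "(val c x (\<psi> \<rightharpoondown> \<chi> \<rightharpoondown> v) - val c x (\<chi> \<rightharpoondown> \<psi> \<rightharpoondown> v)) L =
    (val c x ((\<psi> \<rightharpoondown>\<^sub>v \<chi>) \<rightharpoondown> v) - val c x ((\<chi> \<rightharpoondown>\<^sub>v \<psi>) \<rightharpoondown> v)) L"
    unfolding val_contract fun_diff_def ract_commutator
    by (simp only: ract_diff_left[symmetric] vmat_contract)
qed

text \<open>\<open>A + B\<close> has the matrix \<open>P Q + Q P\<close>. Since
  \<open>P P = 0\<close>, multiplying it by \<open>P\<close> from either side gives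
  \<open>P Q P\<close>.\<close>

lemma psi_commutes_A_plus_B:
  assumes x: "x \<in> chart_image c"
  defines "P \<equiv> vmat c x \<psi>"
  shows "ract P (ract (vmat c x (\<psi> \<rightharpoondown>\<^sub>v \<chi>)) u) + ract P (ract (vmat c x (\<chi> \<rightharpoondown>\<^sub>v \<psi>)) u) =
    ract (vmat c x (\<psi> \<rightharpoondown>\<^sub>v \<chi>)) (ract P u) + ract (vmat c x (\<chi> \<rightharpoondown>\<^sub>v \<psi>)) (ract P u)"
proof
  fix L
  define Q where "Q = vmat c x \<chi>"
  define M where "M j k = (\<Sum>l\<in>UNIV. P l k * Q j l) + (\<Sum>l\<in>UNIV. Q l k * P j l)" for j k
  have PP: "P l k * P m l = 0" for k l m
    using psi_type[OF x] unfolding P_def by (metis mult_eq_0_iff)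
  have "(\<Sum>l\<in>UNIV. P l k * M j l) = (\<Sum>l\<in>UNIV. M l k * P j l)" for j k
  proof -
    have "(\<Sum>l\<in>UNIV. P l k * M j l) = (\<Sum>l\<in>UNIV. \<Sum>m\<in>UNIV. P l k * Q m l * P j m)"
      using PP[of _ k] by (simp add: M_def distrib_left sum_distrib_left mult.assoc[symmetric] del: mult_eq_0_iff)
    also have "\<dots> = (\<Sum>m\<in>UNIV. \<Sum>l\<in>UNIV. P l k * Q m l * P j m)"
      by (rule sum.swap)
    also have "\<dots> = (\<Sum>l\<in>UNIV. M l k * P j l)"
      using PP by (simp add: M_def distrib_right sum_distrib_right mult.assoc del: mult_eq_0_iff)
    finally show ?thesis .
  qed
  then have "ract P (ract M u) L = ract M (ract P u) L"
    using ract_commutator[of P M u L] by (simp add: ract_zero_left)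
  moreover have "M = (\<lambda>j k. vmat c x (\<psi> \<rightharpoondown>\<^sub>v \<chi>) j k + vmat c x (\<chi> \<rightharpoondown>\<^sub>v \<psi>) j k)"
    unfolding M_def vmat_contract P_def Q_def ..
  ultimately show "(ract P (ract (vmat c x (\<psi> \<rightharpoondown>\<^sub>v \<chi>)) u) + ract P (ract (vmat c x (\<chi> \<rightharpoondown>\<^sub>v \<psi>)) u)) L =
    (ract (vmat c x (\<psi> \<rightharpoondown>\<^sub>v \<chi>)) (ract P u) + ract (vmat c x (\<chi> \<rightharpoondown>\<^sub>v \<psi>)) (ract P u)) L"
    by (simp add: ract_add_left[abs_def] ract_add)
qed

text \<open>By the commutator,
  \<open>i i' \<omega> = i' i \<omega> + A \<omega> - B \<omega>\<close>. After one more
  \<open>i\<close> the first term becomes \<open>A i \<omega>\<close>, which equals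
  \<open>i A \<omega> + i B \<omega>\<close> because \<open>i\<close> commutes with
  \<open>A + B\<close>. The terms with \<open>B\<close> cancel and two copies of
  \<open>i A \<omega>\<close> remain.\<close>

lemma psi_psi_chi:
  assumes x: "x \<in> chart_image c"
  shows "val c x (\<psi> \<rightharpoondown> \<psi> \<rightharpoondown> \<chi> \<rightharpoondown> \<omega>) = val c x (\<psi> \<rightharpoondown> A\<omega> + \<psi> \<rightharpoondown> A\<omega>)"
proof -
  define P A B u where "P = vmat c x \<psi>" and "A = vmat c x (\<psi> \<rightharpoondown>\<^sub>v \<chi>)"
    and "B = vmat c x (\<chi> \<rightharpoondown>\<^sub>v \<psi>)" and "u = val c x \<omega>"
  define Q where "Q = vmat c x \<chi>"
  note defs = P_def A_def B_def u_def Q_def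
  have 1: "ract P (ract Q w) - ract Q (ract P w) = ract A w - ract B w"
    if "w = val c x v" for w v
    using commutator_psi_chi[OF x, of v] unfolding that val_contract defs .
  have Psupp: "rsupp S 0 (ract P u)"
    unfolding defs using omega_supp[OF x] psi_type[OF x] by (intro rsupp_ract_lower) auto
  have PPu: "ract P (ract P u) = 0"
    using psi_psi_zero[OF x omega_supp[OF x]] unfolding val_contract defs .
  \<comment> \<open>After one contraction no index of \<open>S\<close> is left, whereas every entry
    of \<open>B\<close> needs one.\<close>
  have BPu: "ract B (ract P u) = 0"
    using ract_rsupp_0[OF Psupp] B_type[OF x] unfolding B_def by (intro ext) auto
  have "ract P (ract Q u) = ract Q (ract P u) + ract A u - ract B u"
    using 1[OF u_def] by (simp add: algebra_simps)
  then have "ract P (ract P (ract Q u)) =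
      ract P (ract Q (ract P u)) + ract P (ract A u) - ract P (ract B u)"
    by (simp only: ract_fun_add ract_fun_diff)
  moreover have "ract P (ract Q (ract P u)) = ract A (ract P u)"
    using 1[of "ract P u" "\<psi> \<rightharpoondown> \<omega>"] unfolding PPu ract_fun_zero BPu
    by (simp add: val_contract P_def u_def)
  moreover have "ract A (ract P u) = ract P (ract A u) + ract P (ract B u)"
    using psi_commutes_A_plus_B[OF x, of u, folded P_def A_def B_def] unfolding BPu by simp
  ultimately show ?thesis
    unfolding val_contract val_add defs by simp
qed

text \<open>For \<open>S = range Inl\<close> these are the two identities at a point, with
  \<open>R1\<close> and \<open>R2\<close> the residuals of the given equations; for
  \<open>S = range Inr\<close> the residuals exchange roles and the conjugate identities
  result.\<close>

lemma second_order:
  assumes x: "x \<in> chart_image c"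
  defines "I \<equiv> ract (vmat c x \<psi>)"
  defines "R1 \<equiv> dsum (- S) (grad c x \<omega>) - dsum (- S) (grad c x (A\<omega> - \<psi> \<rightharpoondown> \<chi> \<rightharpoondown> \<omega>))
      + dsum S (grad c x (\<psi> \<rightharpoondown> \<omega>))"
    and "R2 \<equiv> dsum S (grad c x \<omega>) - dsum S (grad c x (B\<omega> - \<chi> \<rightharpoondown> \<psi> \<rightharpoondown> \<omega>))
      + dsum (- S) (grad c x (\<chi> \<rightharpoondown> \<omega>))"
  shows "6 * dsum (- S) (grad c x (\<psi> \<rightharpoondown> \<omega>)) =
      6 * I R1 - 3 * I (I R2) + I (I (I (dsum S (grad c x (\<chi> \<rightharpoondown> \<omega>)))))"
    and "2 * (dsum S (grad c x (\<psi> \<rightharpoondown> (\<omega> - A\<omega>))) - I (dsum S (grad c x (\<omega> - A\<omega>)))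
        + dsum (- S) (grad c x (\<omega> - A\<omega>))) =
      2 * R1 - 2 * I R2 + I (I (dsum S (grad c x (\<chi> \<rightharpoondown> \<omega>))))"
proof -
  interpret jet_type S "vmat c x \<psi>" "vgrad c x \<psi>"
    by (rule jet_type[OF x])
  \<comment> \<open>The series to which the first-order relations apply at \<open>x\<close>.
    Contraction preserves this class, so they also hold for iterated contractions.\<close>
  define G where "G = {v. sdiff c v \<and> ralt (val c x v)}"
  define D where "D v = dsum S (grad c x v)" for v :: "('a, 'n) form series"
  define D' where "D' v = dsum (- S) (grad c x v)" for v :: "('a, 'n) form series"
  define H where "H = rhor S (vmat c x \<psi>) (vgrad c x \<psi>)"
  define th where "th = \<chi> \<rightharpoondown> \<omega>"
  define a where "a = A\<omega>"
  have G_contract: "\<Phi> \<rightharpoondown> v \<in> G" if "v \<in> G" "vdiff c \<Phi>" for v \<Phi>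
    using that by (auto simp: G_def val_contract intro: sdiff_contract ralt_ract)
  have G: "\<omega> \<in> G" "a \<in> G" "th \<in> G"
    unfolding a_def th_def
    by (auto intro!: G_contract vdiff_contract chi_diff psi_diff)
      (auto simp: G_def omega_diff omega_alt x)
  have Gpsi: "\<psi> \<rightharpoondown> v \<in> G" if "v \<in> G" for v
    using that G_contract psi_diff by blast
  have sd: "sdiff c v" if "v \<in> G" for v
    using that by (simp add: G_def)
  have I_add: "I (u + v) = I u + I v" for u v
    unfolding I_def by (rule ract_fun_add)
  have HI: "H (I u) = I (H u)" for u
    unfolding H_def I_def by (intro ext rhor_ract)
  have vI: "val c x (\<psi> \<rightharpoondown> v) = I (val c x v)" for v
    unfolding I_def by (rule val_contract)
  have D'_psi: "D' (\<psi> \<rightharpoondown> v) = I (D' v) + H (val c x v)" if "v \<in> G" for v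
    unfolding D'_def H_def I_def grad_contract[OF psi_diff sd[OF that] x]
    using that by (intro ext) (simp add: G_def delbar_ract psi_integrable[OF x])
  have D_psi: "D (\<psi> \<rightharpoondown> \<psi> \<rightharpoondown> v) + I (I (D v)) + 2 * H (val c x v) = 2 * I (D (\<psi> \<rightharpoondown> v))"
    if "v \<in> G" for v
    unfolding D_def H_def I_def grad_contract[OF psi_diff sd[OF that] x]
      grad_contract[OF psi_diff sd[OF Gpsi[OF that]] x] val_contract
  proof (intro ext)
    fix L
    show "(dsum S (ract_grad (vmat c x \<psi>) (vgrad c x \<psi>) (ract (vmat c x \<psi>) (val c x v))
          (ract_grad (vmat c x \<psi>) (vgrad c x \<psi>) (val c x v) (grad c x v))) +
        ract (vmat c x \<psi>) (ract (vmat c x \<psi>) (dsum S (grad c x v))) +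
        2 * rhor S (vmat c x \<psi>) (vgrad c x \<psi>) (val c x v)) L =
      (2 * ract (vmat c x \<psi>) (dsum S (ract_grad (vmat c x \<psi>) (vgrad c x \<psi>) (val c x v) (grad c x v)))) L"
      using del_ract_ract[of "val c x v" "grad c x v" L]
      by (simp only: plus_fun_apply times_fun_apply numeral_fun_apply)
  qed
  \<comment> \<open>Vanishing is required on the whole chart image, since \<open>D\<close> and
    \<open>D'\<close> differentiate.\<close>
  have grad0: "D v = 0" "D' v = 0" if "\<And>y. y \<in> chart_image c \<Longrightarrow> val c y v = 0" for v
  proof -
    have "grad c x v = grad c x 0"
      using that by (intro grad_cong[OF open_chart x]) (simp add: val_def[abs_def] fun_eq_iff fps_eq_iff)
    then show "D v = 0" "D' v = 0"
      by (simp_all add: D_def D'_def grad_zero dsum_zero)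
  qed
  have w0: "D (\<psi> \<rightharpoondown> \<psi> \<rightharpoondown> \<omega>) = 0"
    by (rule grad0) (blast intro: psi_psi_zero omega_supp)
  have a0: "D (\<psi> \<rightharpoondown> \<psi> \<rightharpoondown> a) = 0"
    unfolding a_def by (rule grad0) (blast intro: psi_psi_zero A_supp)
  have th0: "D (\<psi> \<rightharpoondown> \<psi> \<rightharpoondown> \<psi> \<rightharpoondown> th) = 0"
  proof (rule grad0)
    fix y assume y: "y \<in> chart_image c"
    show "val c y (\<psi> \<rightharpoondown> \<psi> \<rightharpoondown> \<psi> \<rightharpoondown> th) = 0"
      using psi_psi_chi[OF y] psi_psi_zero[OF y A_supp[OF y]]
      unfolding th_def val_contract val_add by (simp only: ract_fun_add add_0)
  qed
  have "grad c x (\<psi> \<rightharpoondown> \<psi> \<rightharpoondown> th) = grad c x (\<psi> \<rightharpoondown> a + \<psi> \<rightharpoondown> a)"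
    using psi_psi_chi unfolding th_def a_def by (intro grad_cong[OF open_chart x])
  also have "\<dots> = grad c x (\<psi> \<rightharpoondown> a) + grad c x (\<psi> \<rightharpoondown> a)"
    using G sd Gpsi by (intro grad_add x) auto
  finally have th2: "D (\<psi> \<rightharpoondown> \<psi> \<rightharpoondown> th) = 2 * D (\<psi> \<rightharpoondown> a)" "D' (\<psi> \<rightharpoondown> \<psi> \<rightharpoondown> th) = 2 * D' (\<psi> \<rightharpoondown> a)"
    unfolding D_def D'_def by (simp_all only: dsum_add mult_2)
  have ath: "grad c x (a - \<psi> \<rightharpoondown> th) = grad c x a - grad c x (\<psi> \<rightharpoondown> th)"
    using G sd Gpsi by (intro grad_diff x) auto
  have R1: "R1 = D' \<omega> - D' a + D' (\<psi> \<rightharpoondown> th) + D (\<psi> \<rightharpoondown> \<omega>)"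
    unfolding R1_def D_def D'_def a_def[symmetric] th_def[symmetric] ath dsum_diff by simp
  \<comment> \<open>As \<open>[i, i'] = A - B\<close>, the products in \<open>R2\<close> can be
    expressed through \<open>A\<close> and \<open>i i'\<close>, so both residuals involve the same
    \<open>a\<close> and \<open>th\<close>.\<close>
  have "grad c x (B\<omega> - \<chi> \<rightharpoondown> \<psi> \<rightharpoondown> \<omega>) = grad c x (a - \<psi> \<rightharpoondown> th)"
  proof (rule grad_cong[OF open_chart x])
    fix y assume "y \<in> chart_image c"
    from commutator_psi_chi[OF this, of \<omega>]
    show "val c y (B\<omega> - \<chi> \<rightharpoondown> \<psi> \<rightharpoondown> \<omega>) = val c y (a - \<psi> \<rightharpoondown> th)"
      unfolding val_diff th_def a_def by (simp add: algebra_simps)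
  qed
  then have R2: "R2 = D \<omega> - D a + D (\<psi> \<rightharpoondown> th) + D' th"
    unfolding R2_def D_def D'_def th_def[symmetric] by (simp add: ath dsum_diff)
  note main = second_order_identities[of I H G "scontract \<psi>" \<omega> a th "val c x" D' D R1 R2,
      OF I_add HI Gpsi G vI D'_psi D_psi w0 a0 th0 th2 R1 R2]
  show "6 * dsum (- S) (grad c x (\<psi> \<rightharpoondown> \<omega>)) =
      6 * I R1 - 3 * I (I R2) + I (I (I (dsum S (grad c x (\<chi> \<rightharpoondown> \<omega>)))))"
    using main(1) unfolding D_def D'_def th_def .
  have wa: "grad c x (\<omega> - A\<omega>) = grad c x \<omega> - grad c x a"
    unfolding a_def[symmetric] using G sd by (intro grad_diff x) auto
  have "grad c x (\<psi> \<rightharpoondown> (\<omega> - A\<omega>)) = grad c x (\<psi> \<rightharpoondown> \<omega> - \<psi> \<rightharpoondown> a)"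
    by (intro grad_cong[OF open_chart x]) (simp add: val_contract val_diff ract_fun_diff a_def)
  also have "\<dots> = grad c x (\<psi> \<rightharpoondown> \<omega>) - grad c x (\<psi> \<rightharpoondown> a)"
    using G sd Gpsi by (intro grad_diff x) auto
  finally show "2 * (dsum S (grad c x (\<psi> \<rightharpoondown> (\<omega> - A\<omega>))) - I (dsum S (grad c x (\<omega> - A\<omega>)))
        + dsum (- S) (grad c x (\<omega> - A\<omega>))) =
      2 * R1 - 2 * I R2 + I (I (dsum S (grad c x (\<chi> \<rightharpoondown> \<omega>))))"
    using main(2) unfolding D_def D'_def th_def by (simp only: wa dsum_diff)
qed

end

section \<open>Order of vanishing in the parameter and its conjugate\<close>

definition fps2_order :: "nat \<Rightarrow> complex fps fps \<Rightarrow> bool" where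
  "fps2_order n f \<longleftrightarrow> (\<forall>i j. i + j < n \<longrightarrow> f $ i $ j = 0)"

lemma fps2_order_mono: "fps2_order n f \<Longrightarrow> m \<le> n \<Longrightarrow> fps2_order m f"
  by (simp add: fps2_order_def)

lemma fps2_order_0: "fps2_order n 0"
  by (simp add: fps2_order_def)

lemma fps2_order_add: "fps2_order n f \<Longrightarrow> fps2_order n g \<Longrightarrow> fps2_order n (f + g)"
  by (simp add: fps2_order_def)

lemma fps2_order_diff:
  "fps2_order n f \<Longrightarrow> fps2_order n g \<Longrightarrow> fps2_order n (f - g)"
  by (simp add: fps2_order_def)

lemma fps2_order_sum: "(\<And>a. a \<in> A \<Longrightarrow> fps2_order n (f a)) \<Longrightarrow> fps2_order n (\<Sum>a\<in>A. f a)"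
  by (simp add: fps2_order_def fps_sum_nth)

lemma fps2_order_mult:
  fixes f g :: "complex fps fps"
  assumes "fps2_order m f" "fps2_order n g"
  shows "fps2_order (m + n) (f * g)"
  unfolding fps2_order_def fps2_mult_nth
proof (intro allI impI sum.neutral ballI)
  fix i j a b assume "i + j < m + n" "a \<in> {..i}" "b \<in> {..j}"
  then have "a + b < m \<or> (i - a) + (j - b) < n"
    by auto
  then show "f $ a $ b * g $ (i - a) $ (j - b) = 0"
    using assms unfolding fps2_order_def by fastforce
qed

text \<open>Orders add under contraction, which is what makes the induction on the degree
  advance.\<close>

lemma fps2_order_ract:
  fixes u :: "'i::finite list \<Rightarrow> complex fps fps"
  assumes "\<And>j k. fps2_order m (M j k)" "\<And>L. fps2_order n (u L)"
  shows "fps2_order (m + n) (ract M u L)"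
  using assms(2)
  by (induction L arbitrary: u)
    (simp_all add: fps2_order_0 fps2_order_add fps2_order_sum fps2_order_mult assms(1))

text \<open>Removes the factors 6 and 2 of the identities; they are invertible on the complex
  coefficients.\<close>

lemma fps2_order_numeral_cancel:
  fixes f :: "'i \<Rightarrow> complex fps fps"
  assumes "numeral k * f = g" "\<And>L. fps2_order n (g L)"
  shows "fps2_order n (f L)"
proof -
  have "g L = numeral k * f L"
    unfolding assms(1)[symmetric] times_fun_apply numeral_fun_apply ..
  moreover have "(of_nat m * h) $ i $ j = of_nat m * h $ i $ j" for m i j and h :: "complex fps fps"
    by (induction m) (simp_all add: distrib_right)
  from this[of "numeral k" "f L"] have "(numeral k * f L) $ i $ j = numeral k * f L $ i $ j" for i j
    by simp
  ultimately show ?thesis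
    using assms(2)[of L] by (simp add: fps2_order_def)
qed

section \<open>Taylor coefficients of integrable families\<close>

lemma sums_imp_has_fps_expansion:
  fixes f :: "complex \<Rightarrow> complex"
  assumes "0 < r" "\<And>t. t \<in> ball 0 r \<Longrightarrow> (\<lambda>k. a k * t ^ k) sums f t"
  shows "f has_fps_expansion Abs_fps a"
  unfolding has_fps_expansion_def
proof
  \<comment> \<open>Convergence at one nonzero point already gives a positive radius of
    convergence.\<close>
  have "of_real (r / 2) \<in> ball (0 :: complex) r"
    using \<open>0 < r\<close> by simp
  from sums_summable[OF assms(2)[OF this]] have "ereal (norm (of_real (r / 2) :: complex)) \<le> conv_radius a"
    by (rule conv_radius_geI)
  moreover have "0 < ereal (norm (of_real (r / 2) :: complex))"
    using \<open>0 < r\<close> by (simp add: zero_ereal_def)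
  ultimately have "0 < conv_radius a"
    by (rule less_le_trans[rotated])
  then show "0 < fps_conv_radius (Abs_fps a)"
    by (simp add: fps_conv_radius_def Abs_fps_inverse)
  show "\<forall>\<^sub>F z in nhds 0. eval_fps (Abs_fps a) z = f z"
    using eventually_nhds_in_open[of "ball 0 r" "0 :: complex"] \<open>0 < r\<close>
    by (auto elim!: eventually_mono simp: eval_fps_def sums_unique[OF assms(2)])
qed

text \<open>The difference quotients in the direction \<open>v\<close> converge uniformly on a disc, so their
  Taylor coefficients converge as well.\<close>

lemma has_fps_expansion_directional_derivative:
  fixes f :: "'v::real_normed_vector \<Rightarrow> complex \<Rightarrow> complex" and b :: "nat \<Rightarrow> 'v \<Rightarrow> complex"
  assumes "open U" "x \<in> U" "0 < r"
    and diff: "\<And>p. p \<in> U \<times> ball 0 r \<Longrightarrow> (\<lambda>(y, t). f y t) differentiable (at p)"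
    and cont: "continuous_on (U \<times> ball 0 r)
      (\<lambda>p. frechet_derivative (\<lambda>(y, t). f y t) (at p) (v, 0))"
    and hol: "\<And>y. y \<in> U \<Longrightarrow> f y holomorphic_on ball 0 r"
    and sums: "\<And>y t. y \<in> U \<Longrightarrow> t \<in> ball 0 r \<Longrightarrow> (\<lambda>k. b k y * t ^ k) sums f y t"
    and b: "\<And>k. b k differentiable (at x)"
  shows "(\<lambda>t. frechet_derivative (\<lambda>y. f y t) (at x) v) has_fps_expansion
    Abs_fps (\<lambda>k. frechet_derivative (b k) (at x) v)"
proof -
  define DF where "DF p = frechet_derivative (\<lambda>(y, t). f y t) (at p)" for p
  define G where "G s t = DF (x + s *\<^sub>R v, t) (v, 0)" for s t
  \<comment> \<open>A smaller closed disc supplies the compactness for uniform continuity.\<close>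
  define \<rho> where "\<rho> = r / 2"
  have \<rho>: "0 < \<rho>" "cball 0 \<rho> \<subseteq> ball (0 :: complex) r"
    using \<open>0 < r\<close> by (auto simp: \<rho>_def)
  obtain \<delta> where \<delta>: "0 < \<delta>" "cball x \<delta> \<subseteq> U"
    using assms(1,2) open_contains_cball by blast
  \<comment> \<open>Keeps the segment from \<open>x\<close> in direction \<open>v\<close> inside
    \<open>U\<close> for parameters up to \<open>e\<close>; the added 1 covers
    \<open>v = 0\<close>.\<close>
  define e where "e = \<delta> / (norm v + 1)"
  have e: "0 < e"
    using \<delta> by (simp add: e_def add_nonneg_pos)
  have inU: "x + s *\<^sub>R v \<in> U" if "s \<in> {0..e}" for s
  proof -
    have "norm (s *\<^sub>R v) \<le> e * (norm v + 1)"
      using that e by (auto intro!: mult_mono)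
    also have "\<dots> = \<delta>"
      by (simp add: e_def add_nonneg_eq_0_iff)
    finally show ?thesis
      using \<delta> by (auto simp: dist_norm)
  qed
  have deriv: "((\<lambda>s. f (x + s *\<^sub>R v) t) has_vector_derivative G s t) (at s within T)"
    if "s \<in> {0..e}" "t \<in> ball 0 r" for s t T
  proof -
    have "((\<lambda>(y, t). f y t) has_derivative DF (x + s *\<^sub>R v, t)) (at (x + s *\<^sub>R v, t))"
      unfolding DF_def using diff[of "(x + s *\<^sub>R v, t)"] inU[OF that(1)] that(2)
      by (simp add: frechet_derivative_works)
    moreover have "((\<lambda>s. (x + s *\<^sub>R v, t)) has_derivative (\<lambda>h. (h *\<^sub>R v, 0))) (at s within T)"
      by (auto intro!: derivative_eq_intros)
    ultimately have "((\<lambda>s. (\<lambda>(y, t). f y t) (x + s *\<^sub>R v, t)) has_derivative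
        (\<lambda>h. DF (x + s *\<^sub>R v, t) (h *\<^sub>R v, 0))) (at s within T)"
      by (rule has_derivative_compose[rotated])
    moreover have "DF (x + s *\<^sub>R v, t) (h *\<^sub>R v, 0) = h *\<^sub>R G s t" for h
    proof -
      have "linear (DF (x + s *\<^sub>R v, t))"
        unfolding DF_def using diff[of "(x + s *\<^sub>R v, t)"] inU[OF that(1)] that(2)
        by (intro linear_frechet_derivative) auto
      from linear_scale[OF this, of h "(v, 0)"] show ?thesis
        by (simp add: G_def)
    qed
    ultimately show ?thesis
      by (simp add: has_vector_derivative_def)
  qed
  define q where "q h t = (f (x + h *\<^sub>R v) t - f x t) / of_real h" for h :: real and t
  have "continuous_on ({0..e} \<times> cball 0 \<rho>) (\<lambda>(s, t). G s t)"
  proof -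
    have "continuous_on ({0..e} \<times> cball 0 \<rho>) (\<lambda>p. DF (x + fst p *\<^sub>R v, snd p) (v, 0))"
      using inU \<rho>(2) unfolding DF_def
      by (intro continuous_on_compose2[OF cont] continuous_intros) auto
    then show ?thesis
      by (simp add: G_def case_prod_beta)
  qed
  then have unif: "uniformly_continuous_on ({0..e} \<times> cball 0 \<rho>) (\<lambda>(s, t). G s t)"
    by (intro compact_uniformly_continuous compact_Times) auto
  \<comment> \<open>By the mean value inequality \<open>q h t - G 0 t\<close> is bounded by the
    oscillation of \<open>G\<close> along the segment, and uniform continuity makes that small for
    all \<open>t\<close> at once.\<close>
  have lim: "uniform_limit (cball 0 \<rho>) q (G 0) (at_right 0)"
  proof (rule uniform_limitI)
    fix \<epsilon> :: real assume "0 < \<epsilon>"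
    then obtain d where d: "0 < d" "\<And>p p'. p \<in> {0..e} \<times> cball 0 \<rho> \<Longrightarrow> p' \<in> {0..e} \<times> cball 0 \<rho> \<Longrightarrow>
        dist p' p < d \<Longrightarrow> dist ((\<lambda>(s, t). G s t) p') ((\<lambda>(s, t). G s t) p) < \<epsilon> / 2"
      using unif unfolding uniformly_continuous_on_def by (metis half_gt_zero)
    have "\<forall>\<^sub>F h in at_right 0. h \<in> {0<..<min d e}"
      using d(1) e by (intro eventually_at_right_real) auto
    then show "\<forall>\<^sub>F h in at_right 0. \<forall>t\<in>cball 0 \<rho>. dist (q h t) (G 0 t) < \<epsilon>"
    proof eventually_elim
      case (elim h)
      show ?case
      proof
        fix t :: complex assume t: "t \<in> cball 0 \<rho>"
        have "norm (f (x + h *\<^sub>R v) t - f (x + 0 *\<^sub>R v) t - (h - 0) *\<^sub>R G 0 t) \<le> norm (h - 0) * (\<epsilon> / 2)"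
        proof (rule vector_differentiable_bound_linearization[where S = "{0..h}"])
          show "((\<lambda>s. f (x + s *\<^sub>R v) t) has_vector_derivative G s t) (at s within {0..h})"
            if "s \<in> {0..h}" for s
            using that elim t \<rho>(2) by (intro deriv) auto
          show "norm (G s t - G 0 t) \<le> \<epsilon> / 2" if "s \<in> {0..h}" for s
            using d(2)[of "(0, t)" "(s, t)"] that elim t e by (auto simp: dist_norm norm_Pair)
        qed (use elim in \<open>auto simp: closed_segment_eq_real_ivl\<close>)
        then have "norm (f (x + h *\<^sub>R v) t - f x t - of_real h * G 0 t) \<le> h * (\<epsilon> / 2)"
          using elim by (simp add: scaleR_conv_of_real)
        moreover have "f (x + h *\<^sub>R v) t - f x t - of_real h * G 0 t = of_real h * (q h t - G 0 t)"
          using elim by (simp add: q_def field_simps)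
        ultimately have "norm (q h t - G 0 t) \<le> \<epsilon> / 2"
          using elim by (simp add: norm_mult)
        then show "dist (q h t) (G 0 t) < \<epsilon>"
          using \<open>0 < \<epsilon>\<close> by (simp add: dist_norm)
      qed
    qed
  qed
  have small: "\<forall>\<^sub>F h in at_right 0. h \<in> {0<..<e}"
    using e by (intro eventually_at_right_real) auto
  have q_hol: "\<forall>\<^sub>F h in at_right 0. q h holomorphic_on ball 0 r"
    using small
  proof eventually_elim
    case (elim h)
    then show ?case
      unfolding q_def using inU[of h] assms(2) by (intro holomorphic_intros hol) auto
  qed
  have "\<forall>\<^sub>F h in at_right 0. continuous_on (cball 0 \<rho>) (q h) \<and> q h holomorphic_on ball 0 \<rho>"
    using q_hol
  proof eventually_elim
    case (elim h)
    then show ?case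
      using \<rho>(2) ball_subset_cball[of "0 :: complex" \<rho>]
      by (meson holomorphic_on_imp_continuous_on holomorphic_on_subset order_trans)
  qed
  then have G_hol: "G 0 holomorphic_on ball 0 \<rho>"
    by (rule holomorphic_uniform_limit[OF _ lim]) auto
  \<comment> \<open>The \<open>k\<close>-th derivative of \<open>q h\<close> at 0 has two limits:
    that of \<open>G 0\<close>, by uniform convergence of holomorphic functions, and
    \<open>fact k\<close> times the derivative of \<open>b k\<close>, because the Taylor
    coefficients of \<open>q h\<close> are the difference quotients of \<open>b k\<close>.\<close>
  have coeff: "(deriv ^^ k) (G 0) 0 = fact k * frechet_derivative (b k) (at x) v" for k
  proof (rule tendsto_unique)
    show "((\<lambda>h. (deriv ^^ k) (q h) 0) \<longlongrightarrow> (deriv ^^ k) (G 0) 0) (at_right 0)"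
    proof (rule higher_deriv_complex_uniform_limit)
      show "uniform_limit (ball 0 \<rho>) q (G 0) (at_right 0)"
        using lim by (rule uniform_limit_on_subset) (rule ball_subset_cball)
      show "\<forall>\<^sub>F h in at_right 0. q h holomorphic_on ball 0 \<rho>"
        using q_hol
        by eventually_elim (use \<rho>(2) ball_subset_cball[of "0 :: complex" \<rho>] in \<open>meson holomorphic_on_subset order_trans\<close>)
    qed (use \<rho>(1) in auto)
    have "(b k has_derivative frechet_derivative (b k) (at x)) (at (x + 0 *\<^sub>R v))"
      using b[of k] unfolding frechet_derivative_works by simp
    moreover have "((\<lambda>s. x + s *\<^sub>R v) has_derivative (\<lambda>h. h *\<^sub>R v)) (at_right 0)"
      by (auto intro!: derivative_eq_intros)
    ultimately have "((\<lambda>s. b k (x + s *\<^sub>R v)) has_derivative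
        (\<lambda>h. frechet_derivative (b k) (at x) (h *\<^sub>R v))) (at_right 0)"
      by (rule has_derivative_compose[rotated])
    then have "((\<lambda>h. (b k (x + h *\<^sub>R v) - b k x - frechet_derivative (b k) (at x) (h *\<^sub>R v)) /\<^sub>R norm h)
        \<longlongrightarrow> 0) (at_right 0)"
      by (simp add: has_derivative_within scaleR_conv_of_real divide_inverse diff_diff_eq)
    then have "((\<lambda>h. (b k (x + h *\<^sub>R v) - b k x) / of_real h - frechet_derivative (b k) (at x) v)
        \<longlongrightarrow> 0) (at_right 0)"
    proof (rule Lim_transform_eventually)
      show "\<forall>\<^sub>F h in at_right 0.
          (b k (x + h *\<^sub>R v) - b k x - frechet_derivative (b k) (at x) (h *\<^sub>R v)) /\<^sub>R norm h =
          (b k (x + h *\<^sub>R v) - b k x) / of_real h - frechet_derivative (b k) (at x) v"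
        using small
      proof eventually_elim
        case (elim h)
        then show ?case
          using linear_scale[OF linear_frechet_derivative[OF b[of k]], of h v]
          by (simp add: scaleR_conv_of_real field_simps)
      qed
    qed
    then have "((\<lambda>h. (b k (x + h *\<^sub>R v) - b k x) / of_real h)
        \<longlongrightarrow> frechet_derivative (b k) (at x) v) (at_right 0)"
      by (rule LIM_zero_cancel)
    then have "((\<lambda>h. fact k * ((b k (x + h *\<^sub>R v) - b k x) / of_real h))
        \<longlongrightarrow> fact k * frechet_derivative (b k) (at x) v) (at_right 0)"
      by (intro tendsto_intros)
    then show "((\<lambda>h. (deriv ^^ k) (q h) 0)
        \<longlongrightarrow> fact k * frechet_derivative (b k) (at x) v) (at_right 0)"
    proof (rule Lim_transform_eventually)
      show "\<forall>\<^sub>F h in at_right 0. fact k * ((b k (x + h *\<^sub>R v) - b k x) / of_real h) = (deriv ^^ k) (q h) 0"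
        using small
      proof eventually_elim
        case (elim h)
        have "q h has_fps_expansion Abs_fps (\<lambda>k. (b k (x + h *\<^sub>R v) - b k x) / of_real h)"
        proof (rule sums_imp_has_fps_expansion[OF \<open>0 < r\<close>])
          fix t :: complex assume "t \<in> ball 0 r"
          then have "(\<lambda>k. (b k (x + h *\<^sub>R v) * t ^ k - b k x * t ^ k) / of_real h) sums q h t"
            unfolding q_def using elim inU[of h] assms(2)
            by (intro sums_divide sums_diff sums) auto
          then show "(\<lambda>k. (b k (x + h *\<^sub>R v) - b k x) / of_real h * t ^ k) sums q h t"
            by (simp add: left_diff_distrib)
        qed
        from fps_nth_fps_expansion[OF this, of k] show ?case
          by (simp add: field_simps)
      qed
    qed
  qed simp
  have "G 0 has_fps_expansion fps_expansion (G 0) 0"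
    using G_hol \<rho>(1) by (intro has_fps_expansion_fps_expansion[of "ball 0 \<rho>"]) auto
  also have "fps_expansion (G 0) 0 = Abs_fps (\<lambda>k. frechet_derivative (b k) (at x) v)"
    by (rule fps_ext) (simp add: fps_expansion_def coeff)
  \<comment> \<open>By the chain rule along the slice of fixed \<open>t\<close>,
    \<open>G 0 t\<close> is the directional derivative in question for all \<open>t\<close> near
    0.\<close>
  also have "G 0 has_fps_expansion \<dots> \<longleftrightarrow> ?thesis"
  proof (rule has_fps_expansion_cong[OF _ refl])
    have "\<forall>\<^sub>F t in nhds 0. t \<in> ball (0 :: complex) r"
      using \<open>0 < r\<close> by (intro eventually_nhds_in_open) auto
    then show "\<forall>\<^sub>F t in nhds 0. G 0 t = frechet_derivative (\<lambda>y. f y t) (at x) v"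
    proof eventually_elim
      case (elim t)
      have "((\<lambda>(y, t). f y t) has_derivative DF (x, t)) (at (x, t))"
        unfolding DF_def using diff[of "(x, t)"] assms(2) elim by (simp add: frechet_derivative_works)
      moreover have "((\<lambda>y. (y, t)) has_derivative (\<lambda>h. (h, 0))) (at x)"
        by (auto intro!: derivative_eq_intros)
      ultimately have "((\<lambda>y. (\<lambda>(y, t). f y t) (y, t)) has_derivative (\<lambda>h. DF (x, t) (h, 0))) (at x)"
        by (rule has_derivative_compose[rotated])
      from fun_cong[OF frechet_derivative_at[OF this], of v] show ?case
        by (simp add: G_def)
    qed
  qed
  finally show ?thesis .
qed

text \<open>Reads a series in \<open>t\<close> as a double series without the conjugate variable,
  compatibly with the ring operations.\<close>

definition fps2_of_fps :: "complex fps \<Rightarrow> complex fps fps" where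
  "fps2_of_fps F = Abs_fps (\<lambda>a. fps_const (F $ a))"

lemma fps2_of_fps_nth: "fps2_of_fps F $ i $ j = (if j = 0 then F $ i else 0)"
  by (simp add: fps2_of_fps_def)

lemma fps2_of_fps_diff: "fps2_of_fps (F - G) = fps2_of_fps F - fps2_of_fps G"
  by (intro fps2_eqI) (simp add: fps2_of_fps_nth)

lemma fps2_of_fps_mult: "fps2_of_fps (F * G) = fps2_of_fps F * fps2_of_fps G"
proof (rule fps2_eqI)
  fix i j
  show "fps2_of_fps (F * G) $ i $ j = (fps2_of_fps F * fps2_of_fps G) $ i $ j"
    by (cases "j = 0")
      (auto simp: fps2_of_fps_nth fps2_mult_nth fps_mult_nth[of F G] atLeast0AtMost intro!: sum.neutral)
qed

lemma fps2_of_fps_sum: "fps2_of_fps (\<Sum>a\<in>A. F a) = (\<Sum>a\<in>A. fps2_of_fps (F a))"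
  by (intro fps2_eqI) (simp add: fps2_of_fps_nth fps_sum_nth)

section \<open>Integrability in components and in Taylor coefficients\<close>

lemma differentiable_of_beltrami:
  assumes "beltrami \<A> \<Psi>" "c \<in> \<A>" "x \<in> chart_image c"
  shows "(\<lambda>y. \<Psi> c j y L) differentiable (at x)"
proof -
  have "Ck_on (Suc 0) (\<lambda>y. \<Psi> c j y L) (chart_image c)"
    using assms unfolding beltrami_def smooth_on_def by blast
  then show ?thesis using assms(3) by simp
qed

lemma vdelbar_Inr:
  "vdelbar \<Psi> c j x [Inr p, Inr q] =
     wirtinger (Inr p) (\<lambda>y. \<Psi> c j y [Inr q]) x - wirtinger (Inr q) (\<lambda>y. \<Psi> c j y [Inr p]) x"
  by (simp add: vdelbar_def delbar_loc_def sum_fun_apply wedge1_eq_rwedge dw_def pd_covec_def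
      sum_subtractf if_distrib[of "\<lambda>x. x * _"] cong: if_cong)

text \<open>The bracket of \<Psi> with itself contains each product twice, which the factor 1/2
  cancels.\<close>

lemma bracket_self:
  "1 / 2 * bracket \<Psi> \<Psi> c j x [l, m] =
     (\<Sum>s\<in>UNIV. \<Psi> c (Inl s) x [l] * wirtinger (Inl s) (\<lambda>y. \<Psi> c j y [m]) x -
       \<Psi> c (Inl s) x [m] * wirtinger (Inl s) (\<lambda>y. \<Psi> c j y [l]) x)"
  by (simp add: bracket_def sum_fun_apply wedge1_eq_rwedge pd_covec_def sum.distrib
      sum_distrib_left algebra_simps)

text \<open>At a fixed point both sides of the integrability condition expand in powers of
  \<open>t\<close>, and uniqueness of expansions equates the coefficients. Joint smoothness permits
  differentiating the expansion of \<Phi> term by term.\<close>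

lemma holo_series_integrable:
  fixes \<A> :: "('a, 'n::finite) chart set"
  assumes "0 < r" "holomorphic_family \<A> r \<Phi>" "power_series_of \<A> r \<Phi> \<beta>"
    "integrable_family \<A> r \<Phi>"
    and c: "c \<in> \<A>" "open (chart_image c)" "x \<in> chart_image c"
  defines "\<phi> \<equiv> holo_series \<beta>"
  shows "vgrad c x \<phi> (Inr p) j (Inr q) - vgrad c x \<phi> (Inr q) j (Inr p) =
    (\<Sum>s\<in>UNIV. vmat c x \<phi> (Inl s) (Inr p) * vgrad c x \<phi> (Inl s) j (Inr q) -
      vmat c x \<phi> (Inl s) (Inr q) * vgrad c x \<phi> (Inl s) j (Inr p))"
proof -
  \<comment> \<open>The expansion starts in degree 1; the coefficient in degree 0 is set to 0 to
    match \<open>holo_series\<close>.\<close>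
  define b where "b j k i y = (if i = 0 then 0 else \<beta> i c j y [k])" for j k i y
  define F where "F j k = Abs_fps (\<lambda>i. b j k i x)" for j k
  define W where "W s j k = Abs_fps (\<lambda>i. wirtinger s (b j k i) x)" for s j k
  have b_diff: "b j k i differentiable (at x)" for j k i
  proof (cases "i = 0")
    case False
    then have "beltrami \<A> (\<beta> i)"
      using assms(3) by (simp add: power_series_of_def)
    from differentiable_of_beltrami[OF this c(1,3)] False show ?thesis
      by (simp add: b_def[abs_def])
  qed (simp add: b_def[abs_def])
  have sums: "(\<lambda>i. b j k i y * t ^ i) sums \<Phi> t c j y [k]"
    if "y \<in> chart_image c" "t \<in> ball 0 r" for j k y t
  proof -
    have "(\<lambda>i. b j k (Suc i) y * t ^ Suc i) sums \<Phi> t c j y [k]"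
      using assms(3) c(1) that unfolding power_series_of_def b_def by simp
    from sums_Suc[OF this] show ?thesis
      by (simp add: b_def)
  qed
  have F: "(\<lambda>t. \<Phi> t c j x [k]) has_fps_expansion F j k" for j k
    unfolding F_def using sums[OF c(3)] by (rule sums_imp_has_fps_expansion[OF \<open>0 < r\<close>])
  have Dv: "(\<lambda>t. frechet_derivative (\<lambda>y. \<Phi> t c j y [k]) (at x) v) has_fps_expansion
      Abs_fps (\<lambda>i. frechet_derivative (b j k i) (at x) v)" for j k v
  proof (rule has_fps_expansion_directional_derivative[OF c(2,3) \<open>0 < r\<close> _ _ _ sums b_diff])
    have "Ck_on (Suc 0) (\<lambda>(y, t). \<Phi> t c j y [k]) (chart_image c \<times> ball 0 r)"
      using assms(2) c(1) unfolding holomorphic_family_def smooth_on_def by blast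
    then have C1: "\<And>p. p \<in> chart_image c \<times> ball 0 r \<Longrightarrow> (\<lambda>(y, t). \<Phi> t c j y [k]) differentiable (at p)"
      "continuous_on (chart_image c \<times> ball 0 r)
        (\<lambda>p. frechet_derivative (\<lambda>(y, t). \<Phi> t c j y [k]) (at p) (v, 0))"
      by auto
    show "(\<lambda>(y, t). \<Phi> t c j y [k]) differentiable (at p)" if "p \<in> chart_image c \<times> ball 0 r" for p
      using that by (rule C1)
    show "continuous_on (chart_image c \<times> ball 0 r)
        (\<lambda>p. frechet_derivative (\<lambda>(y, t). \<Phi> t c j y [k]) (at p) (v, 0))"
      by (rule C1)
    show "(\<lambda>t. \<Phi> t c j y [k]) holomorphic_on ball 0 r" if "y \<in> chart_image c" for y
      using assms(2) c(1) that unfolding holomorphic_family_def by blast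
  qed
  \<comment> \<open>A Wirtinger derivative combines the directional derivatives along
    \<open>axis a 1\<close> and \<open>axis a \<i>\<close>, whose expansions are given by
    \<open>Dv\<close>.\<close>
  have W: "(\<lambda>t. wirtinger s (\<lambda>y. \<Phi> t c j y [k]) x) has_fps_expansion W s j k" for s j k
  proof (cases s)
    case (Inl a)
    have "(\<lambda>t. (1 / 2) * (frechet_derivative (\<lambda>y. \<Phi> t c j y [k]) (at x) (axis a 1) -
          \<i> * frechet_derivative (\<lambda>y. \<Phi> t c j y [k]) (at x) (axis a \<i>))) has_fps_expansion
        fps_const (1 / 2) * (Abs_fps (\<lambda>i. frechet_derivative (b j k i) (at x) (axis a 1)) -
          fps_const \<i> * Abs_fps (\<lambda>i. frechet_derivative (b j k i) (at x) (axis a \<i>)))"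
      by (intro has_fps_expansion_cmult_left has_fps_expansion_diff Dv)
    also have "fps_const (1 / 2) * (Abs_fps (\<lambda>i. frechet_derivative (b j k i) (at x) (axis a 1)) -
          fps_const \<i> * Abs_fps (\<lambda>i. frechet_derivative (b j k i) (at x) (axis a \<i>))) = W s j k"
      by (rule fps_ext) (simp add: W_def Inl wirtinger_eq_wirt_of wirt_of_def)
    finally show ?thesis
      by (simp add: Inl wirtinger_eq_wirt_of wirt_of_def)
  next
    case (Inr a)
    have "(\<lambda>t. (1 / 2) * (frechet_derivative (\<lambda>y. \<Phi> t c j y [k]) (at x) (axis a 1) +
          \<i> * frechet_derivative (\<lambda>y. \<Phi> t c j y [k]) (at x) (axis a \<i>))) has_fps_expansion
        fps_const (1 / 2) * (Abs_fps (\<lambda>i. frechet_derivative (b j k i) (at x) (axis a 1)) +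
          fps_const \<i> * Abs_fps (\<lambda>i. frechet_derivative (b j k i) (at x) (axis a \<i>)))"
      by (intro has_fps_expansion_cmult_left has_fps_expansion_add Dv)
    also have "fps_const (1 / 2) * (Abs_fps (\<lambda>i. frechet_derivative (b j k i) (at x) (axis a 1)) +
          fps_const \<i> * Abs_fps (\<lambda>i. frechet_derivative (b j k i) (at x) (axis a \<i>))) = W s j k"
      by (rule fps_ext) (simp add: W_def Inr wirtinger_eq_wirt_of wirt_of_def)
    finally show ?thesis
      by (simp add: Inr wirtinger_eq_wirt_of wirt_of_def)
  qed
  have int: "wirtinger (Inr p) (\<lambda>y. \<Phi> t c j y [Inr q]) x - wirtinger (Inr q) (\<lambda>y. \<Phi> t c j y [Inr p]) x =
      (\<Sum>s\<in>UNIV. \<Phi> t c (Inl s) x [Inr p] * wirtinger (Inl s) (\<lambda>y. \<Phi> t c j y [Inr q]) x -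
       \<Phi> t c (Inl s) x [Inr q] * wirtinger (Inl s) (\<lambda>y. \<Phi> t c j y [Inr p]) x)"
    if "t \<in> ball 0 r" for t
  proof -
    have "vdelbar (\<Phi> t) c j x = (\<lambda>L. 1 / 2 * bracket (\<Phi> t) (\<Phi> t) c j x L)"
      using assms(4) that c(1,3) unfolding integrable_family_def vform_eq_def by blast
    from fun_cong[OF this, of "[Inr p, Inr q]"] show ?thesis
      unfolding vdelbar_Inr bracket_self .
  qed
  have "(\<lambda>t. wirtinger (Inr p) (\<lambda>y. \<Phi> t c j y [Inr q]) x - wirtinger (Inr q) (\<lambda>y. \<Phi> t c j y [Inr p]) x)
      has_fps_expansion W (Inr p) j (Inr q) - W (Inr q) j (Inr p)"
    by (intro has_fps_expansion_diff W)
  moreover have "(\<lambda>t. \<Sum>s\<in>UNIV. \<Phi> t c (Inl s) x [Inr p] * wirtinger (Inl s) (\<lambda>y. \<Phi> t c j y [Inr q]) x -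
       \<Phi> t c (Inl s) x [Inr q] * wirtinger (Inl s) (\<lambda>y. \<Phi> t c j y [Inr p]) x) has_fps_expansion
      (\<Sum>s\<in>UNIV. F (Inl s) (Inr p) * W (Inl s) j (Inr q) - F (Inl s) (Inr q) * W (Inl s) j (Inr p))"
    by (intro has_fps_expansion_sum has_fps_expansion_diff has_fps_expansion_mult F W)
  moreover have "\<forall>\<^sub>F t in nhds 0. t \<in> ball (0 :: complex) r"
    using \<open>0 < r\<close> by (intro eventually_nhds_in_open) auto
  ultimately have "W (Inr p) j (Inr q) - W (Inr q) j (Inr p) =
      (\<Sum>s\<in>UNIV. F (Inl s) (Inr p) * W (Inl s) j (Inr q) - F (Inl s) (Inr q) * W (Inl s) j (Inr p))"
    using fps_expansion_unique_complex has_fps_expansion_cong[OF _ refl] int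
    by (smt (verit, best) eventually_mono)
  note coeffs = arg_cong[OF this, of fps2_of_fps, unfolded fps2_of_fps_diff fps2_of_fps_sum fps2_of_fps_mult]
  have "vmat c x \<phi> j k = fps2_of_fps (F j k)" for j k
    by (intro fps2_eqI) (simp add: vmat_def fps2_of_fps_nth F_def b_def \<phi>_def holo_series_def)
  moreover have "vgrad c x \<phi> s j k = fps2_of_fps (W s j k)" for s j k
    by (intro fps2_eqI)
      (auto simp: vgrad_def fps2_of_fps_nth W_def b_def[abs_def] \<phi>_def holo_series_def
        has_wirt_imp_wirtinger[OF has_wirt_const])
  ultimately show ?thesis
    by (simp only: coeffs)
qed

text \<open>Conjugation exchanges \<open>t\<close> with its conjugate, hence the swapped indices.
  Being compatible with sums and products, it carries the integrability of \<phi> over to the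
  conjugate of \<phi>.\<close>

definition conj2 :: "complex fps fps \<Rightarrow> complex fps fps" where
  "conj2 f = fser (\<lambda>i j. cnj (f $ j $ i))"

lemma conj2_nth: "conj2 f $ i $ j = cnj (f $ j $ i)"
  by (simp add: conj2_def)

lemma conj2_diff: "conj2 (f - g) = conj2 f - conj2 g"
  by (intro fps2_eqI) (simp add: conj2_nth)

lemma conj2_sum: "conj2 (\<Sum>a\<in>A. f a) = (\<Sum>a\<in>A. conj2 (f a))"
  by (intro fps2_eqI) (simp add: conj2_nth fps_sum_nth)

lemma conj2_mult: "conj2 (f * g) = conj2 f * conj2 g"
  by (intro fps2_eqI) (simp add: conj2_nth fps2_mult_nth, rule sum.swap)

section \<open>Series of Beltrami differentials and their conjugates\<close>

lemma bar_simps [simp]: "bar (Inl s) = Inr s" "bar (Inr s) = Inl s" "bar (bar i) = i"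
  by (simp_all add: bar_def split: sum.split)

lemma Compl_range_sum: "- range Inl = range Inr" "- range Inr = range Inl"
  by (auto simp: image_iff) (metis sum.exhaust)+

lemma conj_series_nth: "sconj conj_vform \<phi> a b c j x [k] = cnj (\<phi> b a c (bar j) x [bar k])"
  by (simp add: sconj_def conj_vform_def conj_at_def)

lemma vmat_sconj: "vmat c x (sconj conj_vform \<phi>) j k = conj2 (vmat c x \<phi> (bar j) (bar k))"
  by (intro fps2_eqI) (simp add: vmat_def conj2_nth conj_series_nth)

lemma vgrad_sconj:
  assumes "vdiff c \<phi>" "x \<in> chart_image c"
  shows "vgrad c x (sconj conj_vform \<phi>) s j k = conj2 (vgrad c x \<phi> (bar s) (bar j) (bar k))"
proof (rule fps2_eqI)
  fix a b
  have "has_wirt (\<lambda>y. cnj (\<phi> b a c (bar j) y [bar k]))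
      (\<lambda>i. cnj (wirtinger (bar i) (\<lambda>y. \<phi> b a c (bar j) y [bar k]) x)) x"
    using assms unfolding vdiff_def by (intro has_wirt_cnj has_wirt_wirtinger) blast
  then show "vgrad c x (sconj conj_vform \<phi>) s j k $ a $ b = conj2 (vgrad c x \<phi> (bar s) (bar j) (bar k)) $ a $ b"
    by (simp add: vgrad_def conj2_nth conj_series_nth has_wirt_imp_wirtinger)
qed

lemma vdiff_sconj:
  assumes "vdiff c \<phi>"
  shows "vdiff c (sconj conj_vform \<phi>)"
  unfolding vdiff_def conj_series_nth
proof (intro allI ballI)
  fix a b j k x assume "x \<in> chart_image c"
  then have "(\<lambda>y. \<phi> b a c (bar j) y [bar k]) differentiable (at x)"
    using assms unfolding vdiff_def by blast
  then show "(\<lambda>y. cnj (\<phi> b a c (bar j) y [bar k])) differentiable (at x)"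
    by (intro has_wirt_imp_differentiable[OF has_wirt_cnj[OF has_wirt_wirtinger]])
qed

section \<open>Types, differentiability and degrees of the given data\<close>

lemma beltrami_type:
  assumes "beltrami \<A> \<Psi>" "c \<in> \<A>" "x \<in> chart_image c" "\<Psi> c j x [k] \<noteq> 0"
  shows "j \<in> range Inl \<and> k \<notin> range Inl"
proof -
  have b: "bidegree 0 1 (\<Psi> c (Inl s) x)" "\<Psi> c (Inr s) x = 0" for s
    using assms unfolding beltrami_def by blast+
  from assms(4) b(2) obtain s where "j = Inl s"
    by (cases j) auto
  moreover from this have "length (filter isl [k]) = 0"
    using b(1)[of s] assms(4) unfolding bidegree_def by blast
  ultimately show ?thesis by (auto split: if_splits)
qed

lemma holo_series_type:
  assumes "\<forall>i\<ge>1. beltrami \<A> (\<beta> i)" "c \<in> \<A>" "x \<in> chart_image c"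
    "vmat c x (holo_series \<beta>) j k \<noteq> 0"
  shows "j \<in> range Inl \<and> k \<notin> range Inl"
proof -
  obtain a b where "vmat c x (holo_series \<beta>) j k $ a $ b \<noteq> 0"
    using assms(4) by (metis fps2_eqI fps_zero_nth)
  then have "a \<ge> 1 \<and> \<beta> a c j x [k] \<noteq> 0"
    by (simp add: vmat_def holo_series_def split: if_splits)
  then show ?thesis
    using beltrami_type assms(1-3) by blast
qed

lemma vdiff_holo_series:
  assumes "\<forall>i\<ge>1. beltrami \<A> (\<beta> i)" "c \<in> \<A>"
  shows "vdiff c (holo_series \<beta>)"
  unfolding vdiff_def holo_series_def using differentiable_of_beltrami assms by fastforce

lemma sdiff_pq_form:
  assumes "\<And>i j. pq_form \<A> p q (\<omega> i j)" "c \<in> \<A>"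
  shows "sdiff c \<omega>"
proof -
  have "Ck_on (Suc 0) (\<lambda>x. \<omega> i j c x L) (chart_image c)" for i j L
    using assms unfolding pq_form_def smooth_on_def by blast
  then show ?thesis by (simp add: sdiff_def)
qed

lemma ralt_pq_form:
  fixes \<A> :: "('a, 'n::finite) chart set"
  assumes "\<And>i j. pq_form \<A> p q (\<omega> i j)" "c \<in> \<A>" "x \<in> chart_image c"
  shows "ralt (val c x \<omega>)"
  unfolding ralt_def
proof (intro allI fps2_eqI)
  fix K L and a b :: "'n + 'n" and i j
  have "alternating (\<omega> i j c x)"
    using assms unfolding pq_form_def by blast
  moreover have "(K @ b # a # L)[length K := a, Suc (length K) := b] = K @ a # b # L"
    by (simp add: list_update_append)
  ultimately have "\<omega> i j c x (K @ a # b # L) = - \<omega> i j c x (K @ b # a # L)"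
    unfolding alternating_def
    by (elim allE[of _ "K @ b # a # L"] allE[of _ "length K"] allE[of _ "Suc (length K)"])
      (simp add: nth_append)
  then show "val c x \<omega> (K @ a # b # L) $ i $ j = (- val c x \<omega> (K @ b # a # L)) $ i $ j"
    by (simp add: val_def)
qed

lemma rsupp_pq_form:
  fixes \<A> :: "('a, 'n::finite) chart set"
  assumes "\<And>i j. pq_form \<A> p q (\<omega> i j)" "c \<in> \<A>" "x \<in> chart_image c"
  shows "rsupp (range Inl) p (val c x \<omega>)" "rsupp (range Inr) q (val c x \<omega>)"
proof -
  have deg: "length (filter isl L) = p \<and> length (filter (\<lambda>i. \<not> isl i) L) = q"
    if "val c x \<omega> L \<noteq> 0" for L
  proof -
    obtain i j where "val c x \<omega> L $ i $ j \<noteq> 0"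
      using \<open>val c x \<omega> L \<noteq> 0\<close> by (metis fps2_eqI fps_zero_nth)
    then have "\<omega> i j c x L \<noteq> 0"
      by (simp add: val_def)
    moreover have "bidegree p q (\<omega> i j c x)"
      using assms unfolding pq_form_def by blast
    ultimately show ?thesis
      unfolding bidegree_def by blast
  qed
  have "(\<lambda>i :: 'n + 'n. i \<in> range Inl) = isl" "(\<lambda>i :: 'n + 'n. i \<in> range Inr) = (\<lambda>i. \<not> isl i)"
    by (auto simp: fun_eq_iff isl_def image_iff) (metis sum.exhaust)+
  then show "rsupp (range Inl) p (val c x \<omega>)" "rsupp (range Inr) q (val c x \<omega>)"
    using deg unfolding rsupp_def by simp_all
qed

lemma eq_up_to_iff:
  "eq_up_to \<A> N \<alpha> \<beta> \<longleftrightarrow>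
     (\<forall>i j. i + j \<le> N \<longrightarrow> (\<forall>c\<in>\<A>. \<forall>x\<in>chart_image c. \<alpha> i j c x = \<beta> i j c x))"
  unfolding eq_up_to_def series_eq_def form_eq_def hom_part_def by auto

lemma fps2_order_numeral_mult:
  fixes f :: "'i \<Rightarrow> complex fps fps"
  assumes "fps2_order n (f L)"
  shows "fps2_order n ((numeral k * f) L)"
  unfolding times_fun_apply
  using fps2_order_mult[of 0 "numeral k" n "f L"] assms by (simp add: fps2_order_def numeral_fun_apply)

text \<open>Serves the coefficients of a homogeneous part that lie outside its degree.\<close>

lemma delbar_zero: "delbar 0 c x = 0"
  by (intro ext) (simp add: delbar_def delbar_loc_def sum_fun_apply wedge1_eq_rwedge
      pd_covec_def[abs_def] has_wirt_imp_wirtinger[OF has_wirt_const] rwedge_zero)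

section \<open>The order induction and the two conclusions\<close>

theorem proposition2p7:
  fixes X :: "'a topology" and \<A> :: "('a, 'n::finite) chart set"
    and r :: real and \<Phi> :: "complex \<Rightarrow> ('a, 'n) vform" and \<beta> :: "nat \<Rightarrow> ('a, 'n) vform"
    and N :: nat and \<omega> :: "('a, 'n) form series"
    and \<phi> \<phi>bar :: "('a, 'n) vform series"
  assumes "compact_complex_manifold X \<A>"
    and "r > 0" and "holomorphic_family \<A> r \<Phi>" and "power_series_of \<A> r \<Phi> \<beta>"
    and "integrable_family \<A> r \<Phi>"
  defines "\<phi> \<equiv> holo_series \<beta>"
    and "\<phi>bar \<equiv> sconj conj_vform \<phi>"
  assumes "\<And>i j. pq_form \<A> 1 1 (\<omega> i j)"
    and "real_series \<A> \<omega>"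
    and "eq_up_to \<A> N (sdelbar \<omega>)
           (sdelbar ((\<phi> \<rightharpoondown>\<^sub>v \<phi>bar) \<rightharpoondown> \<omega> - \<phi> \<rightharpoondown> \<phi>bar \<rightharpoondown> \<omega>) - sdel (\<phi> \<rightharpoondown> \<omega>))"
    and "eq_up_to \<A> N (sdel \<omega>)
           (sdel ((\<phi>bar \<rightharpoondown>\<^sub>v \<phi>) \<rightharpoondown> \<omega> - \<phi>bar \<rightharpoondown> \<phi> \<rightharpoondown> \<omega>) - sdelbar (\<phi>bar \<rightharpoondown> \<omega>))"
  shows "(\<forall>k\<le>N + 1. series_eq \<A> (sdelbar (hom_part k (\<phi> \<rightharpoondown> \<omega>))) 0) \<and>
         real_series \<A> \<omega> \<and>
         eq_up_to \<A> N
           (commutator sdel (scontract \<phi>) (\<omega> - (\<phi> \<rightharpoondown>\<^sub>v \<phi>bar) \<rightharpoondown> \<omega>) +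
            sdelbar (\<omega> - (\<phi> \<rightharpoondown>\<^sub>v \<phi>bar) \<rightharpoondown> \<omega>)) 0 \<and>
         eq_up_to \<A> N
           (commutator sdelbar (scontract \<phi>bar) (\<omega> - (\<phi>bar \<rightharpoondown>\<^sub>v \<phi>) \<rightharpoondown> \<omega>) +
            sdel (\<omega> - (\<phi>bar \<rightharpoondown>\<^sub>v \<phi>) \<rightharpoondown> \<omega>)) 0"
proof -
  have open_chart: "open (chart_image c)" if "c \<in> \<A>" for c
    using assms(1) that unfolding compact_complex_manifold_def complex_manifold_def by blast
  have beta: "\<forall>i\<ge>1. beltrami \<A> (\<beta> i)"
    using assms(4) unfolding power_series_of_def by blast
  \<comment> \<open>Each chart carries two instances of the same locale, so every identity comes
    with its conjugate.\<close>
  have ext1: "extension_chart c (range Inl) \<phi> \<phi>bar \<omega>"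
    and ext2: "extension_chart c (range Inr) \<phi>bar \<phi> \<omega>" if c: "c \<in> \<A>" for c
  proof -
    have \<phi>_type: "j \<in> range Inl \<and> k \<notin> range Inl"
      if "x \<in> chart_image c" "vmat c x \<phi> j k \<noteq> 0" for x j k
      using holo_series_type[OF beta c] that unfolding \<phi>_def by blast
    have bar_range: "bar j \<in> range Inl \<longleftrightarrow> j \<notin> range Inl" for j :: "'n + 'n"
      by (cases j) auto
    have range_Inr: "j \<in> range Inr \<longleftrightarrow> j \<notin> range Inl" for j :: "'n + 'n"
      by (cases j) auto
    have \<phi>_type': "j \<notin> range Inr \<and> k \<in> range Inr"
      if "x \<in> chart_image c" "vmat c x \<phi> j k \<noteq> 0" for x j k
      using \<phi>_type[OF that] by (simp add: range_Inr)
    have \<phi>bar_type: "j \<notin> range Inl \<and> k \<in> range Inl"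
      if "x \<in> chart_image c" "vmat c x \<phi>bar j k \<noteq> 0" for x j k
    proof -
      have "vmat c x \<phi> (bar j) (bar k) \<noteq> 0"
        using that(2) unfolding \<phi>bar_def vmat_sconj by (auto simp: conj2_def fser_def fps_eq_iff)
      from \<phi>_type[OF that(1) this] show ?thesis
        by (simp add: bar_range)
    qed
    have \<phi>bar_type': "j \<in> range Inr \<and> k \<notin> range Inr"
      if "x \<in> chart_image c" "vmat c x \<phi>bar j k \<noteq> 0" for x j k
      using \<phi>bar_type[OF that] by (simp add: range_Inr)
    have d\<phi>: "vdiff c \<phi>"
      unfolding \<phi>_def by (rule vdiff_holo_series[OF beta c])
    have d\<phi>bar: "vdiff c \<phi>bar"
      unfolding \<phi>bar_def by (rule vdiff_sconj[OF d\<phi>])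
    note int = holo_series_integrable[OF assms(2-5) c open_chart[OF c], folded \<phi>_def]
    note form = assms(8)
    show "extension_chart c (range Inl) \<phi> \<phi>bar \<omega>"
    proof
      fix x and l m j :: "'n + 'n" assume x: "x \<in> chart_image c" and "l \<notin> range Inl" "m \<notin> range Inl"
      then obtain p q where "l = Inr p" "m = Inr q"
        by (cases l; cases m) auto
      then show "vgrad c x \<phi> l j m - vgrad c x \<phi> m j l =
          (\<Sum>s\<in>range Inl. vmat c x \<phi> s l * vgrad c x \<phi> s j m - vmat c x \<phi> s m * vgrad c x \<phi> s j l)"
        by (simp add: int[OF x] sum.reindex)
    qed ((rule \<phi>_type \<phi>bar_type d\<phi> d\<phi>bar open_chart[OF c] sdiff_pq_form[OF form c]
        ralt_pq_form[OF form c] rsupp_pq_form[OF form c]; assumption)+)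
    show "extension_chart c (range Inr) \<phi>bar \<phi> \<omega>"
    proof
      fix x and l m j :: "'n + 'n" assume x: "x \<in> chart_image c" and "l \<notin> range Inr" "m \<notin> range Inr"
      then obtain p q where "l = Inl p" "m = Inl q"
        by (cases l; cases m) auto
      \<comment> \<open>Applying \<open>conj2\<close> to the integrability identity of \<phi> yields
        the one for its conjugate.\<close>
      then show "vgrad c x \<phi>bar l j m - vgrad c x \<phi>bar m j l =
          (\<Sum>s\<in>range Inr. vmat c x \<phi>bar s l * vgrad c x \<phi>bar s j m -
            vmat c x \<phi>bar s m * vgrad c x \<phi>bar s j l)"
        using arg_cong[OF int[OF x, of p "bar j" q], of conj2]
        by (simp only: \<phi>bar_def vmat_sconj vgrad_sconj[OF d\<phi> x] conj2_diff conj2_sum conj2_mult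
            bar_simps sum.reindex[OF inj_Inr] o_def)
    qed ((rule \<phi>_type' \<phi>bar_type' d\<phi> d\<phi>bar open_chart[OF c]
        sdiff_pq_form[OF form c] ralt_pq_form[OF form c] rsupp_pq_form[OF form c]; assumption)+)
  qed

  \<comment> \<open>\<open>X\<close> and \<open>Y\<close> are to be shown of high order;
    \<open>R1\<close> and \<open>R2\<close> are the residuals of the given system, \<open>Z1\<close>
    and \<open>Z2\<close> the left sides of the new one.\<close>
  define X where "X c x = val c x (sdelbar (\<phi> \<rightharpoondown> \<omega>))" for c x
  define Y where "Y c x = val c x (sdel (\<phi>bar \<rightharpoondown> \<omega>))" for c x
  define R1 where "R1 c x = val c x (sdelbar \<omega>)
    - val c x (sdelbar ((\<phi> \<rightharpoondown>\<^sub>v \<phi>bar) \<rightharpoondown> \<omega> - \<phi> \<rightharpoondown> \<phi>bar \<rightharpoondown> \<omega>)) + val c x (sdel (\<phi> \<rightharpoondown> \<omega>))" for c x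
  define R2 where "R2 c x = val c x (sdel \<omega>)
    - val c x (sdel ((\<phi>bar \<rightharpoondown>\<^sub>v \<phi>) \<rightharpoondown> \<omega> - \<phi>bar \<rightharpoondown> \<phi> \<rightharpoondown> \<omega>)) + val c x (sdelbar (\<phi>bar \<rightharpoondown> \<omega>))" for c x
  define Z1 where "Z1 = commutator sdel (scontract \<phi>) (\<omega> - (\<phi> \<rightharpoondown>\<^sub>v \<phi>bar) \<rightharpoondown> \<omega>) +
            sdelbar (\<omega> - (\<phi> \<rightharpoondown>\<^sub>v \<phi>bar) \<rightharpoondown> \<omega>)"
  define Z2 where "Z2 = commutator sdelbar (scontract \<phi>bar) (\<omega> - (\<phi>bar \<rightharpoondown>\<^sub>v \<phi>) \<rightharpoondown> \<omega>) +
            sdel (\<omega> - (\<phi>bar \<rightharpoondown>\<^sub>v \<phi>) \<rightharpoondown> \<omega>)"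

  \<comment> \<open>Order \<open>N + 2\<close> means vanishing in all degrees up to
    \<open>N + 1\<close>. Order \<open>N + 1\<close> reaches degree \<open>N\<close>, exactly as far
    as the given equations hold.\<close>
  have order: "fps2_order (N + 2) (X c x L) \<and> fps2_order (N + 2) (Y c x L) \<and>
      fps2_order (N + 1) (val c x Z1 L) \<and> fps2_order (N + 1) (val c x Z2 L)"
    if c: "c \<in> \<A>" and x: "x \<in> chart_image c" for c x L
  proof -
    define I J where "I = ract (vmat c x \<phi>)" and "J = ract (vmat c x \<phi>bar)"
    note id1 = extension_chart.second_order[OF ext1[OF c] x, unfolded Compl_range_sum,
        folded val_del val_delbar, folded X_def Y_def R1_def R2_def I_def]
    note id2 = extension_chart.second_order[OF ext2[OF c] x, unfolded Compl_range_sum,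
        folded val_del val_delbar, folded X_def Y_def R1_def R2_def J_def]
    have oR1: "fps2_order (N + 1) (R1 c x L)" for L
      using assms(10) c x
      by (auto simp: fps2_order_def R1_def eq_up_to_iff val_def)
    have oR2: "fps2_order (N + 1) (R2 c x L)" for L
      using assms(11) c x
      by (auto simp: fps2_order_def R2_def eq_up_to_iff val_def)
    \<comment> \<open>Both series start in degree 1, so each contraction raises the order by
      one.\<close>
    have o\<phi>: "fps2_order 1 (vmat c x \<phi> j k)" "fps2_order 1 (vmat c x \<phi>bar j k)" for j k
      by (auto simp: fps2_order_def vmat_def \<phi>bar_def conj_series_nth \<phi>_def holo_series_def)
    have oI: "fps2_order (Suc n) (I u L)" if "\<And>L. fps2_order n (u L)" for u n L
      using fps2_order_ract[OF o\<phi>(1) that] by (simp add: I_def)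
    have oJ: "fps2_order (Suc n) (J u L)" if "\<And>L. fps2_order n (u L)" for u n L
      using fps2_order_ract[OF o\<phi>(2) that] by (simp add: J_def)
    \<comment> \<open>The bounds for \<open>X\<close> and \<open>Y\<close> feed each other: three
      contractions turn order \<open>m\<close> of one into order \<open>m + 3\<close> of its
      contribution to the other. The residuals are contracted at least once and contribute order
      \<open>N + 2\<close>, which is where the induction stops.\<close>
    have XY: "(\<forall>L. fps2_order m (X c x L)) \<and> (\<forall>L. fps2_order m (Y c x L))" if "m \<le> N + 2" for m
      using that
    proof (induction m)
      case 0
      then show ?case by (simp add: fps2_order_def)
    next
      case (Suc m)
      then have IH: "fps2_order m (X c x L)" "fps2_order m (Y c x L)" for L
        by auto
      have mono: "fps2_order (Suc m) f" if "fps2_order n f" "Suc m \<le> n" for n f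
        using that by (rule fps2_order_mono)
      have "fps2_order (Suc m) ((6 * I (R1 c x) - 3 * I (I (R2 c x)) + I (I (I (Y c x)))) L)"
        "fps2_order (Suc m) ((6 * J (R2 c x) - 3 * J (J (R1 c x)) + J (J (J (X c x)))) L)" for L
        unfolding plus_fun_apply fun_diff_def
        using Suc.prems
        by (intro fps2_order_add fps2_order_diff fps2_order_numeral_mult
            mono[OF oI[OF oR1]] mono[OF oI[OF oI[OF oR2]]] mono[OF oI[OF oI[OF oI[OF IH(2)]]]]
            mono[OF oJ[OF oR2]] mono[OF oJ[OF oJ[OF oR1]]] mono[OF oJ[OF oJ[OF oJ[OF IH(1)]]]]; simp)+
      then show ?case
        using fps2_order_numeral_cancel[OF id1(1)] fps2_order_numeral_cancel[OF id2(1)] by blast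
    qed
    then have oX: "fps2_order (N + 2) (X c x L)" and oY: "fps2_order (N + 2) (Y c x L)" for L
      by auto
    have mono: "fps2_order (N + 1) f" if "fps2_order n f" "N + 1 \<le> n" for n f
      using that by (rule fps2_order_mono)
    \<comment> \<open>Each identity contains one residual without contraction, so one degree less is
      reached than for \<open>X\<close> and \<open>Y\<close>.\<close>
    have oZ: "fps2_order (N + 1) ((2 * R1 c x - 2 * I (R2 c x) + I (I (Y c x))) L)"
      "fps2_order (N + 1) ((2 * R2 c x - 2 * J (R1 c x) + J (J (X c x))) L)" for L
      unfolding plus_fun_apply fun_diff_def
      by (intro fps2_order_add fps2_order_diff fps2_order_numeral_mult oR1 oR2
          mono[OF oI[OF oR2]] mono[OF oI[OF oI[OF oY]]]
          mono[OF oJ[OF oR1]] mono[OF oJ[OF oJ[OF oX]]]; simp)+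
    have eq1: "2 * val c x Z1 = 2 * R1 c x - 2 * I (R2 c x) + I (I (Y c x))"
      using id1(2) unfolding Z1_def commutator_def val_add val_diff val_contract[of c x \<phi> "sdel _"] I_def .
    have eq2: "2 * val c x Z2 = 2 * R2 c x - 2 * J (R1 c x) + J (J (X c x))"
      using id2(2) unfolding Z2_def commutator_def val_add val_diff val_contract[of c x \<phi>bar "sdelbar _"] J_def .
    have "fps2_order (N + 1) (val c x Z1 L)" "fps2_order (N + 1) (val c x Z2 L)" for L
      by (rule fps2_order_numeral_cancel[OF eq1 oZ(1)], rule fps2_order_numeral_cancel[OF eq2 oZ(2)])
    with oX oY show ?thesis by blast
  qed

  have Z: "eq_up_to \<A> N Z1 0" "eq_up_to \<A> N Z2 0"
    using order unfolding eq_up_to_iff by (auto simp: fps2_order_def val_def fun_eq_iff less_Suc_eq_le)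
  have "delbar (hom_part k (\<phi> \<rightharpoondown> \<omega>) i j) c x = 0"
    if "k \<le> N + 1" "c \<in> \<A>" "x \<in> chart_image c" for k i j c x
  proof (cases "i + j = k")
    case True
    then have "X c x L $ i $ j = 0" for L
      using order[OF that(2,3), of L] that(1) unfolding fps2_order_def by simp
    then show ?thesis
      using True by (intro ext) (simp add: hom_part_def X_def val_def smap_def)
  next
    case False
    then show ?thesis
      by (simp add: hom_part_def delbar_zero)
  qed
  then have "\<forall>k\<le>N + 1. series_eq \<A> (sdelbar (hom_part k (\<phi> \<rightharpoondown> \<omega>))) 0"
    unfolding series_eq_def form_eq_def smap_def by simp
  with Z assms(9) show ?thesis
    unfolding Z1_def Z2_def by blast
qed

end
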